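(* Let $E: y^2=f(x)=x^3+ax^2+bx+c$ ($a,b,c\in K$) be an elliptic curve over $K$ with point at infinity $O$ as zero element, and let $T=(x_T,y_T)\in E(K)$ be a torsion point of order $n\ge 2$. Let $J=\langle (x-x_T)^n,\ (x-x_T)^{n-1}(y-y_T),\ \ldots,\ (y-y_T)^n,\ y^2-f\rangle\subset\overline{K}[x,y]$, let $\mathcal{G}_2$ be the reduced Gröbner basis of $J$ with respect to $>_2$, and let $b_{nT}$ be the element of $\mathcal{G}_2\setminus\{y^2-f\}$ with minimum multidegree with respect to $>_2$. Then: (1) $b_{nT}=b_0+b_1y$ for some $b_0,b_1\in\overline{K}[x]$, and $\mathrm{div}([b_{nT}])=nT-nO$; (2) $b_0^2-b_1^2f=r(x-x_T)^n$ for some $r\in K^{\times}$; (3) if $K=\mathbb{C}$, the plane curve given by $b_{nT}=0$ is a weak $n$-contact curve to $E$ whose only affine contact point is $T$.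
   Context: $K$ is a field with $\mathrm{char}(K)\ne2$, $\overline{K}$ an algebraic closure; $f$ has no multiple roots in $\overline{K}$. For $h\in\overline{K}[x,y]$, $[h]$ is its class in $\overline{K}[E]=\overline{K}[x,y]/\langle y^2-f\rangle$, regarded as a rational function on $E$. $>_2$ is the following monomial order on $\overline{K}[x,y]$: with $\mathrm{wdeg}(y^mx^n)=3m+2n$, $y^{m_1}x^{n_1}>_2y^{m_2}x^{n_2}$ iff $\mathrm{wdeg}(y^{m_1}x^{n_1})>\mathrm{wdeg}(y^{m_2}x^{n_2})$, or these weights are equal and $n_1<n_2$. The multidegree of a polynomial with respect to $>_2$ is the exponent of its leading monomial; multidegrees are compared via $>_2$. $E$ is also regarded as a smooth cubic in $\mathbb{P}^2$, and an affine plane curve is identified with its projective closure. A plane curve $D$ is a weak $n$-contact curve to $E$ if the divisor $D|_E$ cut out by $D$ on $E$ has the form $D|_E=n\left(\sum_{i=1}^dP_i\right)+sO$ for some non-negative integer $s$; the affine points $P_i$ are its affine contact points. *)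

theory Defs
  imports Complex_Main "HOL-Library.Multiset"
    "HOL-Computational_Algebra.Computational_Algebra"
begin

section \<open>Fields and their algebraic closures\<close>

definition field_hom :: "('k::field \<Rightarrow> 'l::field) \<Rightarrow> bool" where
  "field_hom \<phi> \<longleftrightarrow> \<phi> 1 = 1 \<and> (\<forall>x y. \<phi> (x + y) = \<phi> x + \<phi> y) \<and> (\<forall>x y. \<phi> (x * y) = \<phi> x * \<phi> y)"

definition algebraic_closure_emb :: "('k::field \<Rightarrow> 'l::alg_closed_field) \<Rightarrow> bool" where
  "algebraic_closure_emb \<iota> \<longleftrightarrow> field_hom \<iota> \<and> (\<forall>z. \<exists>p. p \<noteq> 0 \<and> poly (map_poly \<iota> p) z = 0)"


section \<open>Polynomials in two variables\<close>

text \<open>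
  An element of $k[x,y]$ is a polynomial in $y$ with coefficients in $k[x]$. The pair
  \<open>(m, n)\<close> stands for the monomial $y^m x^n$.
\<close>

definition coeff2 :: "'a::zero poly poly \<Rightarrow> nat \<times> nat \<Rightarrow> 'a" where
  "coeff2 h e = coeff (coeff h (fst e)) (snd e)"

definition supp2 :: "'a::zero poly poly \<Rightarrow> (nat \<times> nat) set" where
  "supp2 h = {e. coeff2 h e \<noteq> 0}"

definition term2 :: "'a::zero \<Rightarrow> nat \<times> nat \<Rightarrow> 'a poly poly" where
  "term2 c e = monom (monom c (snd e)) (fst e)"

definition eval2 :: "'a::comm_ring_1 poly poly \<Rightarrow> 'a \<Rightarrow> 'a \<Rightarrow> 'a" where
  "eval2 h p q = poly (poly h [:q:]) p"

definition ideal_gen :: "'r::comm_ring_1 set \<Rightarrow> 'r set" where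
  "ideal_gen S = module.span (*) S"

text \<open>The ideal $\langle x-p,\, y-q\rangle^k + \langle F\rangle$.\<close>

definition point_power_ideal ::
    "'a::comm_ring_1 poly poly \<Rightarrow> 'a \<Rightarrow> 'a \<Rightarrow> nat \<Rightarrow> 'a poly poly set" where
  "point_power_ideal F p q k =
     ideal_gen ({[:[:- p, 1:]:] ^ (k - j) * [:[:- q:], 1:] ^ j | j. j \<le> k} \<union> {F})"


section \<open>The monomial order and reduced Groebner bases\<close>

definition wdeg :: "nat \<times> nat \<Rightarrow> nat" where
  "wdeg e = 3 * fst e + 2 * snd e"

definition gt2 :: "nat \<times> nat \<Rightarrow> nat \<times> nat \<Rightarrow> bool" (infix \<open>>\<^sub>2\<close> 50) where
  "e1 >\<^sub>2 e2 \<longleftrightarrow> wdeg e1 > wdeg e2 \<or> (wdeg e1 = wdeg e2 \<and> snd e1 < snd e2)"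

text \<open>Meaningful for \<open>h \<noteq> 0\<close> only; the leading term of \<open>0\<close> is nevertheless \<open>0\<close>.\<close>

definition multideg :: "'a::zero poly poly \<Rightarrow> nat \<times> nat" where
  "multideg h = (THE e. e \<in> supp2 h \<and> (\<forall>e'\<in>supp2 h. e' \<noteq> e \<longrightarrow> e >\<^sub>2 e'))"

definition lead_coeff2 :: "'a::zero poly poly \<Rightarrow> 'a" where
  "lead_coeff2 h = coeff2 h (multideg h)"

definition lead_term2 :: "'a::zero poly poly \<Rightarrow> 'a poly poly" where
  "lead_term2 h = term2 (lead_coeff2 h) (multideg h)"

definition groebner_basis ::
    "'a::field poly poly set \<Rightarrow> 'a poly poly set \<Rightarrow> bool" where
  "groebner_basis J G \<longleftrightarrow>
     finite G \<and> G \<subseteq> J \<and> ideal_gen (lead_term2 ` G) = ideal_gen (lead_term2 ` J)"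

definition reduced_groebner_basis ::
    "'a::field poly poly set \<Rightarrow> 'a poly poly set \<Rightarrow> bool" where
  "reduced_groebner_basis J G \<longleftrightarrow>
     groebner_basis J G \<and>
     (\<forall>g\<in>G. lead_coeff2 g = 1 \<and>
        (\<forall>e\<in>supp2 g. term2 1 e \<notin> ideal_gen (lead_term2 ` (G - {g}))))"


section \<open>Elliptic curves\<close>

definition cubic :: "'a::comm_ring_1 \<Rightarrow> 'a \<Rightarrow> 'a \<Rightarrow> 'a poly" where
  "cubic a b c = [:c, b, a, 1:]"

text \<open>The polynomial $y^2 - f$.\<close>

definition curve_eq :: "'a::comm_ring_1 poly \<Rightarrow> 'a poly poly" where
  "curve_eq f = [:- f, 0, 1:]"

datatype 'a ec_point = Inf | Aff 'a 'a

definition ec_points :: "'a::comm_ring_1 poly \<Rightarrow> 'a ec_point set" where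
  "ec_points f = {Inf} \<union> {Aff x y | x y. y ^ 2 = poly f x}"

text \<open>
  Chord-tangent addition on $y^2 = x^3 + ax^2 + bx + c$ with zero \<open>Inf\<close>;
  \<open>c\<close> does not occur in the formulas.
\<close>

fun ec_add :: "'a::field \<Rightarrow> 'a \<Rightarrow> 'a ec_point \<Rightarrow> 'a ec_point \<Rightarrow> 'a ec_point" where
  "ec_add a b Inf Q = Q"
| "ec_add a b (Aff x1 y1) Inf = Aff x1 y1"
| "ec_add a b (Aff x1 y1) (Aff x2 y2) =
     (if x1 = x2 \<and> y1 = - y2 then Inf
      else let l = (if x1 = x2 then (3 * x1 ^ 2 + 2 * a * x1 + b) / (2 * y1)
                    else (y2 - y1) / (x2 - x1));
               x3 = l ^ 2 - a - x1 - x2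
           in Aff x3 (l * (x1 - x3) - y1))"

definition ec_mult :: "'a::field \<Rightarrow> 'a \<Rightarrow> nat \<Rightarrow> 'a ec_point \<Rightarrow> 'a ec_point" where
  "ec_mult a b n P = (ec_add a b P ^^ n) Inf"

definition ec_has_order :: "'a::field \<Rightarrow> 'a \<Rightarrow> 'a ec_point \<Rightarrow> nat \<Rightarrow> bool" where
  "ec_has_order a b P n \<longleftrightarrow>
     n > 0 \<and> ec_mult a b n P = Inf \<and> (\<forall>m. 0 < m \<and> m < n \<longrightarrow> ec_mult a b m P \<noteq> Inf)"


section \<open>Projective plane curves\<close>

text \<open>
  A polynomial in $x, y, z$ is a polynomial in $z$ with coefficients in $k[x][y]$:
  the coefficient of $x^i y^j z^k$ in \<open>H\<close> is \<open>coeff (coeff (coeff H k) j) i\<close>.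
\<close>

definition total_degree2 :: "'a::zero poly poly \<Rightarrow> nat" where
  "total_degree2 h = Max (insert 0 ((\<lambda>e. fst e + snd e) ` supp2 h))"

definition homogenize :: "'a::comm_ring_1 poly poly \<Rightarrow> 'a poly poly poly" where
  "homogenize h =
     (\<Sum>e\<in>supp2 h. monom (term2 (coeff2 h e) e) (total_degree2 h - (fst e + snd e)))"

definition projective_plane_curve :: "'a::comm_ring_1 poly poly poly \<Rightarrow> bool" where
  "projective_plane_curve H \<longleftrightarrow> H \<noteq> 0 \<and>
     (\<exists>d\<ge>1. \<forall>i j k. coeff (coeff (coeff H k) j) i \<noteq> 0 \<longrightarrow> i + j + k = d)"

text \<open>
  \<open>Aff x y\<close> is the point $[x:y:1]$ and \<open>Inf\<close> is $[0:1:0]$. Near an affine point a form is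
  dehomogenized by $z = 1$, with coordinates $(x, y)$; near \<open>Inf\<close> by $y = 1$, with coordinates
  $(x, z)$, in which \<open>Inf\<close> is the origin. In both cases the result is a polynomial in the second
  coordinate over polynomials in the first.
\<close>

fun local_eq :: "'a::comm_ring_1 poly poly poly \<Rightarrow> 'a ec_point \<Rightarrow> 'a poly poly" where
  "local_eq H (Aff x y) = poly H 1"
| "local_eq H Inf = map_poly (\<lambda>q. poly q 1) H"

fun local_coords :: "'a::zero ec_point \<Rightarrow> 'a \<times> 'a" where
  "local_coords (Aff x y) = (x, y)"
| "local_coords Inf = (0, 0)"


section \<open>Divisors on the elliptic curve\<close>

text \<open>
  The valuation of \<open>h\<close> in the local ring at the smooth point \<open>(p, q)\<close> of the curve $F = 0$, i.e.
  the largest $k$ such that \<open>h\<close> lies in the $k$-th power of the maximal ideal; the factor \<open>s\<close>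
  is the denominator coming from the localization. Meaningful only if \<open>h\<close> does not vanish
  identically on the curve.
\<close>

definition ord_at :: "'a::field poly poly \<Rightarrow> 'a \<Rightarrow> 'a \<Rightarrow> 'a poly poly \<Rightarrow> nat" where
  "ord_at F p q h =
     (GREATEST k. \<exists>s. eval2 s p q \<noteq> 0 \<and> s * h \<in> point_power_ideal F p q k)"

text \<open>
  Divisors on the curve $E: y^2 = f$ over an algebraically closed field are integer-valued functions
  on points, zero off $E$. The next function is the divisor cut out on $E$ by a form \<open>H\<close>.
\<close>

definition cut_divisor :: "'a::field poly \<Rightarrow> 'a poly poly poly \<Rightarrow> 'a ec_point \<Rightarrow> int" where
  "cut_divisor f H P =
     (if P \<in> ec_points f
      then int (ord_at (local_eq (homogenize (curve_eq f)) P)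
                  (fst (local_coords P)) (snd (local_coords P)) (local_eq H P))
      else 0)"

text \<open>
  The class of \<open>h\<close>, a polynomial of total degree $d$ with homogenization $H$, is the rational
  function $H/z^d$ on $E$.
\<close>

definition div_fun :: "'a::field poly \<Rightarrow> 'a poly poly \<Rightarrow> 'a ec_point \<Rightarrow> int" where
  "div_fun f h P =
     cut_divisor f (homogenize h) P - int (total_degree2 h) * cut_divisor f (monom 1 1) P"

definition point_div :: "'a ec_point \<Rightarrow> 'a ec_point \<Rightarrow> int" where
  "point_div P = (\<lambda>Q. if Q = P then 1 else 0)"

text \<open>The affine contact points are counted with repetition.\<close>

definition affine_contact_points ::
    "'a::field poly \<Rightarrow> nat \<Rightarrow> 'a poly poly poly \<Rightarrow> 'a ec_point multiset \<Rightarrow> bool" where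
  "affine_contact_points f n D Ps \<longleftrightarrow>
     set_mset Ps \<subseteq> ec_points f - {Inf} \<and>
     (\<exists>s::nat. cut_divisor f D =
        (\<lambda>Q. int n * (\<Sum>P\<in>#Ps. point_div P Q) + int s * point_div Inf Q))"

text \<open>The divisor cut out by \<open>D\<close> exists only if $E$ is not a component of \<open>D\<close>.\<close>

definition weak_contact_curve :: "'a::field poly \<Rightarrow> nat \<Rightarrow> 'a poly poly poly \<Rightarrow> bool" where
  "weak_contact_curve f n D \<longleftrightarrow>
     projective_plane_curve D \<and> \<not> homogenize (curve_eq f) dvd D \<and>
     (\<exists>Ps. affine_contact_points f n D Ps)"

end

theory Submission
  imports Defs
begin

text \<open>
  Miller's algorithm, run along the multiples of $T$, produces a function $\beta = \beta_0 + \beta_1 y$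
  in the product of $n$ copies of the maximal ideal $(x - x_T, y - y_T)$ whose norm
  $\beta_0^2 - \beta_1^2 f$ has degree $n$; ideal products replace divisors throughout. The weight of
  an element of $K[x] + K[x] y$ is the degree of its norm, and the norm of an element of $J$ is
  divisible by $(x - x_T)^n$. The Groebner basis contains an element whose leading monomial divides
  that of $\beta$, so the minimal element $b_{nT}$ has weight at most $n$; hence its norm is a
  constant times $(x - x_T)^n$, with constant $\pm 1$ because $b_{nT}$ is monic. The norm
  determines the orders of vanishing at all affine points, and the weight gives the order at $O$.
\<close>

text \<open>Membership in a product of point ideals bounds orders of vanishing from below only. The
  matching upper bounds come from the degree of the norm, which leaves no room for zeros beyond
  those already forced. Miller's recursion has to cope with coincidences: tangents, points of order
  two, a multiple of T that meets T again. Products indexed by lists of points treat all of them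
  alike, at the price of two memberships that vanishing at the points does not give: a line lies in
  the product of the ideals of its three intersection points, and x - p in that of P and -P. This is
  where smoothness of E enters. The order of T makes \<beta> close up: the extra zero -(n-1)T left
  by the recursion is T itself. The norm also settles the field of definition. The coefficients of
  b_nT lie in the closure, but the weights 2i of x^i and 2j + 3 of x^j y differ in parity, so the
  leading terms of b_0^2 and b_1^2 f cannot cancel. Hence the norm of a monic element has leading
  coefficient 1 or -1, and r lies in K without any descent argument.\<close>

text \<open>No interpretation: it would make \<open>module.scale_scale\<close>, i.e. \<open>a * (b * x) = (a * b) * x\<close>,
  a rewrite rule, which loops with \<open>mult.assoc\<close>.\<close>

lemma module_mult: "module ((*) :: 'a::comm_ring_1 \<Rightarrow> 'a \<Rightarrow> 'a)"
  by standard (simp_all add: algebra_simps)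

lemmas ideal_span_minimal = module.span_minimal[OF module_mult]
  and ideal_span_base = module.span_base[OF module_mult]
  and ideal_span_scale = module.span_scale[OF module_mult]
  and ideal_span_add = module.span_add[OF module_mult]
  and ideal_span_zero = module.span_zero[OF module_mult]
  and ideal_span_induct = module.span_induct[OF module_mult]
  and ideal_subspace_def = module.subspace_def[OF module_mult]

section \<open>Products of point ideals\<close>

definition x_minus :: "'a::comm_ring_1 \<Rightarrow> 'a poly poly" where
  "x_minus p = [:[:- p, 1:]:]"

definition y_minus :: "'a::comm_ring_1 \<Rightarrow> 'a poly poly" where
  "y_minus q = [:[:- q:], 1:]"

text \<open>The product of the ideals (x - p_i, y - q_i), plus (F): it plays the role of the
  functions on the curve that vanish on the effective divisor given by the list. A recursion instead
  of a span lets a member be split one point at a time. \<open>F\<close> is added at each level, so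
  that membership depends only on the class modulo \<open>F\<close>.\<close>

primrec points_ideal :: "'a::comm_ring_1 poly poly \<Rightarrow> ('a \<times> 'a) list \<Rightarrow> 'a poly poly set" where
  "points_ideal F [] = UNIV"
| "points_ideal F (P # Ps) =
     {x_minus (fst P) * g + y_minus (snd P) * h + F * k | g h k.
        g \<in> points_ideal F Ps \<and> h \<in> points_ideal F Ps}"

declare points_ideal.simps(2) [simp del]

lemma points_ideal_ConsI:
  "\<lbrakk>g \<in> points_ideal F Ps; h \<in> points_ideal F Ps;
    r = x_minus (fst P) * g + y_minus (snd P) * h + F * k\<rbrakk> \<Longrightarrow> r \<in> points_ideal F (P # Ps)"
  unfolding points_ideal.simps(2) by blast

lemma points_ideal_ConsE:
  assumes "r \<in> points_ideal F (P # Ps)"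
  obtains g h k where "g \<in> points_ideal F Ps" "h \<in> points_ideal F Ps"
    "r = x_minus (fst P) * g + y_minus (snd P) * h + F * k"
  using assms unfolding points_ideal.simps(2) by blast

lemma points_ideal_modulus: "F * k \<in> points_ideal F Ps"
proof (induction Ps arbitrary: k)
  case (Cons P Ps)
  have "0 \<in> points_ideal F Ps" using Cons[of 0] by simp
  then show ?case by (intro points_ideal_ConsI[where g = 0 and h = 0 and k = k]) auto
qed simp

lemma points_ideal_zero: "0 \<in> points_ideal F Ps"
  using points_ideal_modulus[of F 0] by simp

lemma points_ideal_add:
  "g \<in> points_ideal F Ps \<Longrightarrow> h \<in> points_ideal F Ps \<Longrightarrow> g + h \<in> points_ideal F Ps"
proof (induction Ps arbitrary: g h)
  case (Cons P Ps)
  from Cons.prems(1) obtain g1 g2 k where g: "g1 \<in> points_ideal F Ps" "g2 \<in> points_ideal F Ps"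
    "g = x_minus (fst P) * g1 + y_minus (snd P) * g2 + F * k" by (rule points_ideal_ConsE)
  from Cons.prems(2) obtain h1 h2 l where h: "h1 \<in> points_ideal F Ps" "h2 \<in> points_ideal F Ps"
    "h = x_minus (fst P) * h1 + y_minus (snd P) * h2 + F * l" by (rule points_ideal_ConsE)
  show ?case
    by (rule points_ideal_ConsI[OF Cons.IH[OF g(1) h(1)] Cons.IH[OF g(2) h(2)], where k = "k + l"])
      (simp only: g(3) h(3) ring_distribs ac_simps)
qed simp

lemma points_ideal_mult: "h \<in> points_ideal F Ps \<Longrightarrow> r * h \<in> points_ideal F Ps"
proof (induction Ps arbitrary: h)
  case (Cons P Ps)
  from Cons.prems(1) obtain g1 g2 k where g: "g1 \<in> points_ideal F Ps" "g2 \<in> points_ideal F Ps"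
    "h = x_minus (fst P) * g1 + y_minus (snd P) * g2 + F * k" by (rule points_ideal_ConsE)
  show ?case
    by (rule points_ideal_ConsI[OF Cons.IH[OF g(1)] Cons.IH[OF g(2)], where k = "r * k"])
      (simp only: g(3) ring_distribs ac_simps)
qed simp

lemma points_ideal_mult_right: "h \<in> points_ideal F Ps \<Longrightarrow> h * r \<in> points_ideal F Ps"
  using points_ideal_mult[of h F Ps r] by (simp add: mult.commute)

lemma points_ideal_diff:
  "g \<in> points_ideal F Ps \<Longrightarrow> h \<in> points_ideal F Ps \<Longrightarrow> g - h \<in> points_ideal F Ps"
  using points_ideal_add[of g F Ps "(-1) * h"] points_ideal_mult[of h F Ps "-1"] by simp

lemma points_ideal_dvd: "F dvd h \<Longrightarrow> h \<in> points_ideal F Ps"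
  by (auto simp: dvd_def points_ideal_modulus)

lemma points_ideal_cong:
  "F dvd g - h \<Longrightarrow> g \<in> points_ideal F Ps \<longleftrightarrow> h \<in> points_ideal F Ps"
  using points_ideal_dvd[of F "g - h" Ps] points_ideal_add[of "g - h" F Ps h]
    points_ideal_diff[of g F Ps "g - h"] by auto

lemma points_ideal_x: "g \<in> points_ideal F Ps \<Longrightarrow> x_minus (fst P) * g \<in> points_ideal F (P # Ps)"
  by (rule points_ideal_ConsI[of g F Ps 0 _ _ 0]) (auto simp: points_ideal_zero)

lemma points_ideal_y: "g \<in> points_ideal F Ps \<Longrightarrow> y_minus (snd P) * g \<in> points_ideal F (P # Ps)"
  by (rule points_ideal_ConsI[of 0 F Ps g _ _ 0]) (auto simp: points_ideal_zero)

lemma points_ideal_Cons_subset: "points_ideal F (P # Ps) \<subseteq> points_ideal F Ps"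
proof
  fix r assume "r \<in> points_ideal F (P # Ps)"
  then obtain g h k where "g \<in> points_ideal F Ps" "h \<in> points_ideal F Ps"
    "r = x_minus (fst P) * g + y_minus (snd P) * h + F * k" by (rule points_ideal_ConsE)
  then show "r \<in> points_ideal F Ps"
    by (simp add: points_ideal_add points_ideal_mult points_ideal_modulus)
qed

lemma points_ideal_Cons_mono:
  "points_ideal F Ps \<subseteq> points_ideal F Qs \<Longrightarrow> points_ideal F (P # Ps) \<subseteq> points_ideal F (P # Qs)"
  unfolding points_ideal.simps by blast

lemma points_ideal_swap: "points_ideal F (P # Q # Ps) \<subseteq> points_ideal F (Q # P # Ps)"
proof
  fix r assume "r \<in> points_ideal F (P # Q # Ps)"
  then obtain g h k where r: "g \<in> points_ideal F (Q # Ps)" "h \<in> points_ideal F (Q # Ps)"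
    "r = x_minus (fst P) * g + y_minus (snd P) * h + F * k" by (rule points_ideal_ConsE)
  \<comment> \<open>\<open>s\<close> stands for x - p or y - q, so that one argument moves both
    summands of \<open>r\<close> past \<open>Q\<close>.\<close>
  have main: "s * g \<in> points_ideal F (Q # P # Ps)"
    if g: "g \<in> points_ideal F (Q # Ps)"
      and s: "\<And>g. g \<in> points_ideal F Ps \<Longrightarrow> s * g \<in> points_ideal F (P # Ps)" for s g
  proof -
    from g obtain g1 g2 k where g: "g1 \<in> points_ideal F Ps" "g2 \<in> points_ideal F Ps"
      "g = x_minus (fst Q) * g1 + y_minus (snd Q) * g2 + F * k" by (rule points_ideal_ConsE)
    show ?thesis
      by (rule points_ideal_ConsI[OF s[OF g(1)] s[OF g(2)], where k = "s * k"])
        (simp only: g(3) ring_distribs ac_simps)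
  qed
  show "r \<in> points_ideal F (Q # P # Ps)"
    unfolding r(3) by (intro points_ideal_add points_ideal_modulus main r points_ideal_x points_ideal_y)
qed

lemma points_ideal_move: "points_ideal F (P # As @ Bs) \<subseteq> points_ideal F (As @ P # Bs)"
proof (induction As)
  case (Cons A As)
  have "points_ideal F (P # A # As @ Bs) \<subseteq> points_ideal F (A # P # As @ Bs)"
    by (rule points_ideal_swap)
  also have "\<dots> \<subseteq> points_ideal F (A # As @ P # Bs)"
    by (rule points_ideal_Cons_mono[OF Cons])
  finally show ?case by simp
qed simp

text \<open>Ideal products commute, so a list of points matters only as a divisor. This brings a
  pair R, -R to the front, where it can be cancelled.\<close>

lemma points_ideal_mset:
  "mset Ps = mset Qs \<Longrightarrow> points_ideal F Ps \<subseteq> points_ideal F Qs"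
proof (induction Ps arbitrary: Qs)
  case (Cons P Ps)
  have "P \<in> set Qs" using mset_eq_setD[OF Cons.prems] by auto
  then obtain As Bs where Qs: "Qs = As @ P # Bs" using split_list by metis
  with Cons.prems have "mset Ps = mset (As @ Bs)" by simp
  then have "points_ideal F (P # Ps) \<subseteq> points_ideal F (P # As @ Bs)"
    by (intro points_ideal_Cons_mono Cons.IH)
  with points_ideal_move Qs show ?case by blast
qed simp

lemma points_ideal_append:
  "g \<in> points_ideal F Ps \<Longrightarrow> h \<in> points_ideal F Qs \<Longrightarrow> g * h \<in> points_ideal F (Ps @ Qs)"
proof (induction Ps arbitrary: g)
  case (Cons P Ps)
  from Cons.prems(1) obtain g1 g2 k where g: "g1 \<in> points_ideal F Ps" "g2 \<in> points_ideal F Ps"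
    "g = x_minus (fst P) * g1 + y_minus (snd P) * g2 + F * k" by (rule points_ideal_ConsE)
  show ?case unfolding append_Cons
    by (rule points_ideal_ConsI[OF Cons.IH[OF g(1) Cons.prems(2)] Cons.IH[OF g(2) Cons.prems(2)],
          where k = "k * h"]) (simp only: g(3) ring_distribs ac_simps)
qed (simp add: points_ideal_mult)

lemma points_ideal_power:
  "g \<in> points_ideal F [P] \<Longrightarrow> g ^ k \<in> points_ideal F (replicate k P)"
  by (induction k) (use points_ideal_append[of g F "[P]"] in auto)

lemma points_ideal_replicate_antimono:
  "j \<le> k \<Longrightarrow> points_ideal F (replicate k P) \<subseteq> points_ideal F (replicate j P)"
proof (induction k)
  case (Suc k)
  then show ?case using points_ideal_Cons_subset[of F P "replicate k P"]
    by (cases "j = Suc k") auto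
qed simp

text \<open>Gives both \<open>J\<close> and the ideals in \<open>ord_at\<close> the form in which
  members can be split recursively: the monomials of degree \<open>k + 1\<close> in x - p and y - q
  are those of degree \<open>k\<close> times one more factor.\<close>

lemma point_power_ideal_eq_points_ideal:
  "point_power_ideal F p q k = points_ideal F (replicate k (p, q))"
proof
  have gen: "x_minus p ^ i * y_minus q ^ j \<in> points_ideal F (replicate (i + j) (p, q))" for i j
  proof -
    have "x_minus p \<in> points_ideal F [(p, q)]" "y_minus q \<in> points_ideal F [(p, q)]"
      using points_ideal_x[of 1 F "[]" "(p, q)"] points_ideal_y[of 1 F "[]" "(p, q)"]
      by simp_all
    then show ?thesis unfolding replicate_add by (intro points_ideal_append points_ideal_power)
  qed
  show "point_power_ideal F p q k \<subseteq> points_ideal F (replicate k (p, q))"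
    unfolding point_power_ideal_def ideal_gen_def x_minus_def[symmetric] y_minus_def[symmetric]
  proof (rule ideal_span_minimal)
    show "{x_minus p ^ (k - j) * y_minus q ^ j |j. j \<le> k} \<union> {F}
        \<subseteq> points_ideal F (replicate k (p, q))"
    proof -
      have "x_minus p ^ (k - j) * y_minus q ^ j \<in> points_ideal F (replicate k (p, q))"
        if "j \<le> k" for j
        using gen[of "k - j" j] that by simp
      then show ?thesis using points_ideal_modulus[of F 1] by auto
    qed
    show "module.subspace (*) (points_ideal F (replicate k (p, q)))"
      by (simp add: ideal_subspace_def points_ideal_zero points_ideal_add points_ideal_mult)
  qed
next
  show "points_ideal F (replicate k (p, q)) \<subseteq> point_power_ideal F p q k"
  proof (induction k)
    case 0
    have "h \<in> module.span (*) ({[:[:- p, 1:]:] ^ (0 - j) * [:[:- q:], 1:] ^ j |j. j \<le> 0} \<union> {F})" for h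
      using ideal_span_scale[OF ideal_span_base[of 1], of _ h] by simp
    then show ?case unfolding point_power_ideal_def ideal_gen_def by blast
  next
    case (Suc k)
    let ?S = "\<lambda>k. {x_minus p ^ (k - j) * y_minus q ^ j |j. j \<le> k} \<union> {F}"
    have J: "point_power_ideal F p q k = module.span (*) (?S k)" for k
      by (simp only: point_power_ideal_def ideal_gen_def x_minus_def y_minus_def)
    have F: "F * h \<in> module.span (*) (?S (Suc k))" for h
      using ideal_span_scale[OF ideal_span_base[of F "?S (Suc k)"], of h] by (simp add: mult.commute)
    \<comment> \<open>Multiplication by \<open>s\<close> preserves sums and multiples, so it
      suffices to look at the generators; used with x - p and y - q for \<open>s\<close>.\<close>
    have sub: "s * g \<in> module.span (*) (?S (Suc k))"
      if g: "g \<in> module.span (*) (?S k)" and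
        s: "\<And>j. j \<le> k \<Longrightarrow> s * (x_minus p ^ (k - j) * y_minus q ^ j) \<in> module.span (*) (?S (Suc k))" for s g
      using g
    proof (rule ideal_span_induct)
      show "module.subspace (*) {g. s * g \<in> module.span (*) (?S (Suc k))}"
      proof -
        have "s * (c * g) \<in> module.span (*) (?S (Suc k))" if "s * g \<in> module.span (*) (?S (Suc k))" for c g
          using ideal_span_scale[OF that, of c] by (simp only: mult.left_commute)
        then show ?thesis
          by (simp add: ideal_subspace_def ideal_span_zero distrib_left ideal_span_add)
      qed
    qed (use s F[of s] in \<open>auto simp only: mem_Collect_eq mult.commute[of s F] Un_iff singleton_iff\<close>)
    have x: "x_minus p * g \<in> module.span (*) (?S (Suc k))" if "g \<in> module.span (*) (?S k)" for g
    proof (rule sub[OF that])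
      fix j assume j: "j \<le> k"
      have "x_minus p * (x_minus p ^ (k - j) * y_minus q ^ j)
          = x_minus p ^ (Suc k - j) * y_minus q ^ j"
        unfolding Suc_diff_le[OF j] power_Suc mult.assoc ..
      with j show "x_minus p * (x_minus p ^ (k - j) * y_minus q ^ j) \<in> module.span (*) (?S (Suc k))"
        by (intro ideal_span_base UnI1 CollectI exI[of _ j]) simp
    qed
    have y: "y_minus q * g \<in> module.span (*) (?S (Suc k))" if "g \<in> module.span (*) (?S k)" for g
    proof (rule sub[OF that])
      fix j assume j: "j \<le> k"
      have "y_minus q * (x_minus p ^ (k - j) * y_minus q ^ j)
          = x_minus p ^ (Suc k - Suc j) * y_minus q ^ Suc j"
        unfolding diff_Suc_Suc power_Suc by (rule mult.left_commute)
      with j show "y_minus q * (x_minus p ^ (k - j) * y_minus q ^ j) \<in> module.span (*) (?S (Suc k))"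
        by (intro ideal_span_base UnI1 CollectI exI[of _ "Suc j"]) simp
    qed
    show ?case
    proof
      fix r assume "r \<in> points_ideal F (replicate (Suc k) (p, q))"
      then obtain g h l where r: "g \<in> points_ideal F (replicate k (p, q))"
        "h \<in> points_ideal F (replicate k (p, q))" "r = x_minus p * g + y_minus q * h + F * l"
        unfolding replicate_Suc by (rule points_ideal_ConsE[where P = "(p, q)", unfolded fst_conv snd_conv])
      from subsetD[OF Suc r(1)] subsetD[OF Suc r(2)]
      have "g \<in> module.span (*) (?S k)" "h \<in> module.span (*) (?S k)" unfolding J .
      then show "r \<in> point_power_ideal F p q (Suc k)"
        unfolding J r(3) by (intro ideal_span_add x y F)
    qed
  qed
qed

section \<open>Evaluation at a point\<close>

lemma eval2_add [simp]: "eval2 (g + h) p q = eval2 g p q + eval2 h p q"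
  and eval2_diff [simp]: "eval2 (g - h) p q = eval2 g p q - eval2 h p q"
  and eval2_mult [simp]: "eval2 (g * h) p q = eval2 g p q * eval2 h p q"
  and eval2_power [simp]: "eval2 (g ^ k) p q = eval2 g p q ^ k"
  and eval2_0 [simp]: "eval2 0 p q = 0"
  and eval2_1 [simp]: "eval2 1 p q = 1"
  and eval2_x_minus [simp]: "eval2 (x_minus r) p q = p - r"
  and eval2_y_minus [simp]: "eval2 (y_minus r) p q = q - r"
  and eval2_linear: "eval2 [:h0, h1:] p q = poly h0 p + q * poly h1 p"
  and eval2_const: "eval2 [:h0:] p q = poly h0 p"
  by (simp_all add: eval2_def x_minus_def y_minus_def)

lemma eval2_eq_0_of_dvd: "F dvd h \<Longrightarrow> eval2 F p q = 0 \<Longrightarrow> eval2 h p q = 0"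
  by (auto simp: dvd_def)

text \<open>Dividing by y - q and then by x - p leaves the value at the point as remainder.\<close>

lemma mem_points_ideal_iff_eval2:
  assumes "eval2 F p q = 0"
  shows "h \<in> points_ideal F [(p, q)] \<longleftrightarrow> eval2 h p q = 0"
proof
  assume "h \<in> points_ideal F [(p, q)]"
  then obtain g1 g2 k where "h = x_minus (fst (p, q)) * g1 + y_minus (snd (p, q)) * g2 + F * k"
    by (rule points_ideal_ConsE)
  then show "eval2 h p q = 0" using assms by simp
next
  assume h: "eval2 h p q = 0"
  have "[:[:- q:], 1:] dvd h - [:poly h [:q:]:]"
    using poly_eq_0_iff_dvd[of "h - [:poly h [:q:]:]" "[:q:]"] by simp
  then obtain u where u: "h - [:poly h [:q:]:] = y_minus q * u"
    unfolding y_minus_def by (rule dvdE)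
  have "[:-p, 1:] dvd poly h [:q:]" using h by (simp add: eval2_def poly_eq_0_iff_dvd)
  then obtain v where v: "poly h [:q:] = [:-p, 1:] * v" by (rule dvdE)
  have "h = [:poly h [:q:]:] + (h - [:poly h [:q:]:])" by simp
  also have "\<dots> = x_minus (fst (p, q)) * [:v:] + y_minus (snd (p, q)) * u + F * 0"
    unfolding u unfolding v by (simp add: x_minus_def)
  finally show "h \<in> points_ideal F [(p, q)]" by (rule points_ideal_ConsI[rotated 2]) auto
qed

section \<open>The coordinate ring\<close>

text \<open>The pullback of functions along the inversion P -> -P of E.\<close>

definition conj_y :: "'a::comm_ring_1 poly poly \<Rightarrow> 'a poly poly" where
  "conj_y h = pcompose h [:0, -1:]"

lemma conj_y_add: "conj_y (g + h) = conj_y g + conj_y h"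
  and conj_y_mult: "conj_y (g * h) = conj_y g * conj_y h"
  and conj_y_linear: "conj_y [:h0, h1:] = [:h0, - h1:]"
  and conj_y_x_minus: "conj_y (x_minus p) = x_minus p"
  and conj_y_y_minus: "conj_y (y_minus q) = - y_minus (- q)"
  and conj_y_curve_eq: "conj_y (curve_eq f) = curve_eq f"
  by (simp_all add: conj_y_def pcompose_add pcompose_mult x_minus_def y_minus_def curve_eq_def
      pcompose_pCons)

lemma eval2_conj_y: "eval2 (conj_y h) p q = eval2 h p (- q)"
  by (simp add: eval2_def conj_y_def poly_pcompose)

definition neg_point :: "'a::uminus \<times> 'a \<Rightarrow> 'a \<times> 'a" where
  "neg_point P = (fst P, - snd P)"

lemma neg_point_simps [simp]: "fst (neg_point P) = fst P" "snd (neg_point P) = - snd P"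
  "neg_point (p, q) = (p, - q)"
  by (simp_all add: neg_point_def)

lemma conj_y_mem_points_ideal:
  "h \<in> points_ideal (curve_eq f) Ps \<Longrightarrow> conj_y h \<in> points_ideal (curve_eq f) (map neg_point Ps)"
proof (induction Ps arbitrary: h)
  case (Cons P Ps)
  from Cons.prems obtain g1 g2 k where g: "g1 \<in> points_ideal (curve_eq f) Ps"
    "g2 \<in> points_ideal (curve_eq f) Ps"
    "h = x_minus (fst P) * g1 + y_minus (snd P) * g2 + curve_eq f * k" by (rule points_ideal_ConsE)
  have "(-1) * conj_y g2 \<in> points_ideal (curve_eq f) (map neg_point Ps)"
    by (intro points_ideal_mult Cons.IH g)
  then show ?case unfolding list.map
    by (rule points_ideal_ConsI[OF Cons.IH[OF g(1)], where k = "conj_y k"])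
      (simp only: g(3) conj_y_add conj_y_mult conj_y_x_minus conj_y_y_minus conj_y_curve_eq
        neg_point_simps mult_minus_left mult_minus_right mult_1_left minus_minus)
qed simp

text \<open>Modulo the curve, (y - q)(y + q) = f - f(p), which vanishes at p. Through this relation
  a pair of opposite points produces a factor x - p.\<close>

lemma y_minus_mult_conj:
  assumes "q\<^sup>2 = poly f p"
  shows "\<exists>u. y_minus q * y_minus (- q) = curve_eq f + x_minus p * [:u:]"
proof -
  have "[:-p, 1:] dvd f - [:q\<^sup>2:]" using assms by (simp add: poly_eq_0_iff_dvd[symmetric])
  then obtain u where u: "f - [:q\<^sup>2:] = [:-p, 1:] * u" by (rule dvdE)
  have "y_minus q * y_minus (- q) = curve_eq f + [:f - [:q\<^sup>2:]:]"
    by (simp add: y_minus_def curve_eq_def power2_eq_square)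
  then show ?thesis unfolding u by (auto simp: x_minus_def)
qed

text \<open>Ideal form of P + (-P) ~ 2 O, for all points of the list at once. Of the four products
  of a generator at P with a generator at -P, three contain x - p visibly and the fourth is
  \<open>y_minus_mult_conj\<close>.\<close>

lemma points_ideal_mult_neg:
  assumes "\<And>P. P \<in> set Ps \<Longrightarrow> (snd P)\<^sup>2 = poly f (fst P)"
    and "g \<in> points_ideal (curve_eq f) Ps" "h \<in> points_ideal (curve_eq f) (map neg_point Ps)"
  shows "\<exists>k. curve_eq f dvd g * h - (\<Prod>P\<leftarrow>Ps. x_minus (fst P)) * k"
  using assms
proof (induction Ps arbitrary: g h)
  case (Cons P Ps)
  let ?F = "curve_eq f"
  obtain g1 g2 k where g: "g1 \<in> points_ideal ?F Ps" "g2 \<in> points_ideal ?F Ps"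
    "g = x_minus (fst P) * g1 + y_minus (snd P) * g2 + ?F * k"
    using Cons.prems(2) by (rule points_ideal_ConsE)
  obtain h1 h2 l where h: "h1 \<in> points_ideal ?F (map neg_point Ps)"
    "h2 \<in> points_ideal ?F (map neg_point Ps)"
    "h = x_minus (fst P) * h1 + y_minus (- snd P) * h2 + ?F * l"
    using Cons.prems(3) unfolding list.map by (rule points_ideal_ConsE[where P = "neg_point P", unfolded neg_point_simps])
  obtain u where u: "y_minus (snd P) * y_minus (- snd P) = ?F + x_minus (fst P) * [:u:]"
    using y_minus_mult_conj[of "snd P" f "fst P"] Cons.prems(1)[of P] by auto
  define D where "D = (\<Prod>P\<leftarrow>Ps. x_minus (fst P))"
  have ex: "\<exists>k m. a * b = D * k + ?F * m"
    if a: "a \<in> points_ideal ?F Ps" and b: "b \<in> points_ideal ?F (map neg_point Ps)" for a b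
  proof -
    obtain k where "?F dvd a * b - D * k"
      using Cons.IH[OF _ a b] Cons.prems(1) unfolding D_def by auto
    then obtain m where "a * b - D * k = ?F * m" by (rule dvdE)
    then have "a * b = D * k + ?F * m" by (simp only: diff_eq_eq add.commute)
    then show ?thesis by blast
  qed
  obtain k11 m11 where e11: "g1 * h1 = D * k11 + ?F * m11" using ex[OF g(1) h(1)] by blast
  obtain k12 m12 where e12: "g1 * h2 = D * k12 + ?F * m12" using ex[OF g(1) h(2)] by blast
  obtain k21 m21 where e21: "g2 * h1 = D * k21 + ?F * m21" using ex[OF g(2) h(1)] by blast
  obtain k22 m22 where e22: "g2 * h2 = D * k22 + ?F * m22" using ex[OF g(2) h(2)] by blast
  define X Y Z where "X = x_minus (fst P)" and "Y = y_minus (snd P)" and "Z = y_minus (- snd P)"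
  have "(X * g1 + Y * g2) * (X * h1 + Z * h2)
      = X * (X * (g1 * h1) + Z * (g1 * h2) + Y * (g2 * h1)) + (Y * Z) * (g2 * h2)"
    by (simp only: ring_distribs ac_simps)
  also have "\<dots> = X * (X * (D * k11 + ?F * m11) + Z * (D * k12 + ?F * m12) + Y * (D * k21 + ?F * m21))
      + (?F * (g2 * h2) + X * [:u:] * (D * k22 + ?F * m22))"
    unfolding e11 e12 e21 u[folded X_def Y_def Z_def] distrib_right[of ?F] e22 ..
  also have "\<dots> = (X * D) * (X * k11 + Z * k12 + Y * k21 + [:u:] * k22)
        + ?F * (X * (X * m11 + Z * m12 + Y * m21 + [:u:] * m22) + g2 * h2)"
    by (simp only: ring_distribs ac_simps)
  finally have main: "(X * g1 + Y * g2) * (X * h1 + Z * h2)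
      = (X * D) * (X * k11 + Z * k12 + Y * k21 + [:u:] * k22)
        + ?F * (X * (X * m11 + Z * m12 + Y * m21 + [:u:] * m22) + g2 * h2)" .
  have "g * h = (X * g1 + Y * g2) * (X * h1 + Z * h2) + ?F * (k * h + (X * g1 + Y * g2) * l)"
    unfolding g(3) h(3) X_def[symmetric] Y_def[symmetric] Z_def[symmetric]
    by (simp only: ring_distribs ac_simps)
  also have "\<dots> = (X * D) * (X * k11 + Z * k12 + Y * k21 + [:u:] * k22)
      + ?F * (X * (X * m11 + Z * m12 + Y * m21 + [:u:] * m22) + g2 * h2 + k * h
          + (X * g1 + Y * g2) * l)"
    unfolding main by (simp only: ring_distribs ac_simps)
  finally have "g * h = (X * D) * (X * k11 + Z * k12 + Y * k21 + [:u:] * k22)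
      + ?F * (X * (X * m11 + Z * m12 + Y * m21 + [:u:] * m22) + g2 * h2 + k * h
          + (X * g1 + Y * g2) * l)" .
  then have "?F dvd g * h - (X * D) * (X * k11 + Z * k12 + Y * k21 + [:u:] * k22)"
    by (simp only: add_diff_cancel_left' dvd_triv_left)
  then show ?case unfolding D_def X_def by (intro exI) simp
qed (simp, metis diff_self dvd_0_right)

text \<open>Horner's scheme in y, with y (h0 + h1 y) = f h1 + h0 y on E at each step.\<close>

lemma curve_eq_reduce: "\<exists>h0 h1. curve_eq f dvd h - [:h0, h1:]"
proof (induction h)
  case 0
  show ?case by (auto intro!: exI[of _ 0])
next
  case (pCons a h)
  then obtain h0 h1 where "curve_eq f dvd h - [:h0, h1:]" by blast
  then obtain k where "h - [:h0, h1:] = curve_eq f * k" by (rule dvdE)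
  then have h: "h = [:h0, h1:] + curve_eq f * k" by (simp only: diff_eq_eq add.commute)
  have "pCons a h = [:a:] + [:0, 1:] * h" by simp
  also have "\<dots> = [:a + f * h1, h0:] + curve_eq f * ([:h1:] + [:0, 1:] * k)"
    unfolding h by (simp add: curve_eq_def algebra_simps)
  finally have "pCons a h - [:a + f * h1, h0:] = curve_eq f * ([:h1:] + [:0, 1:] * k)"
    by (simp only: add_diff_cancel_left')
  then have "curve_eq f dvd pCons a h - [:a + f * h1, h0:]" by (rule dvdI)
  then show ?case by blast
qed

lemma curve_eq_dvd_linear_iff:
  fixes f :: "'a::idom poly"
  shows "curve_eq f dvd [:h0, h1:] \<longleftrightarrow> h0 = 0 \<and> h1 = 0"
proof
  assume "curve_eq f dvd [:h0, h1:]"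
  moreover have "degree [:h0, h1:] < degree (curve_eq f)" by (simp add: curve_eq_def)
  ultimately have "[:h0, h1:] = 0" using dvd_imp_degree_le by (metis linorder_not_less)
  then show "h0 = 0 \<and> h1 = 0" by simp
qed simp

text \<open>The coordinate ring is free over \<open>K[x]\<close> with basis 1, y, so a nonzero
  element of \<open>K[x]\<close> can be cancelled.\<close>

lemma curve_eq_dvd_const_mult_iff:
  fixes f :: "'a::idom poly"
  assumes "u \<noteq> 0"
  shows "curve_eq f dvd [:u:] * h \<longleftrightarrow> curve_eq f dvd h"
proof
  assume *: "curve_eq f dvd [:u:] * h"
  obtain h0 h1 where h: "curve_eq f dvd h - [:h0, h1:]" using curve_eq_reduce by blast
  then have "curve_eq f dvd [:u:] * (h - [:h0, h1:])" by (rule dvd_mult)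
  from dvd_diff[OF * this] have "curve_eq f dvd [:u * h0, u * h1:]"
    by (simp add: algebra_simps)
  then have "h0 = 0 \<and> h1 = 0" unfolding curve_eq_dvd_linear_iff using assms by simp
  with h show "curve_eq f dvd h" by simp
qed (rule dvd_mult)

section \<open>The norm from the coordinate ring to \<open>K[x]\<close>\<close>

definition curve_norm :: "'a::comm_ring_1 poly \<Rightarrow> 'a poly \<Rightarrow> 'a poly \<Rightarrow> 'a poly" where
  "curve_norm f h0 h1 = h0\<^sup>2 - h1\<^sup>2 * f"

lemma mult_conj_y_curve_norm:
  "curve_eq f dvd [:h0, h1:] * conj_y [:h0, h1:] - [:curve_norm f h0 h1:]"
proof
  show "[:h0, h1:] * conj_y [:h0, h1:] - [:curve_norm f h0 h1:] = curve_eq f * [:- h1\<^sup>2:]"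
    by (simp add: conj_y_linear curve_norm_def curve_eq_def power2_eq_square)
qed

lemma x_minus_power: "x_minus p ^ k = [:[:-p, 1:] ^ k:]"
  by (induction k) (simp_all add: x_minus_def one_pCons)

text \<open>The norm is the product of an element of the k-th power of the ideal at P and its
  conjugate, which lies in the k-th power of the ideal at -P.\<close>

lemma curve_norm_dvd:
  fixes f :: "'a::idom poly"
  assumes "q\<^sup>2 = poly f p" "[:h0, h1:] \<in> points_ideal (curve_eq f) (replicate k (p, q))"
  shows "[:-p, 1:] ^ k dvd curve_norm f h0 h1"
proof -
  obtain l where l: "curve_eq f dvd [:h0, h1:] * conj_y [:h0, h1:]
      - (\<Prod>P\<leftarrow>replicate k (p, q). x_minus (fst P)) * l"
    using points_ideal_mult_neg[OF _ assms(2) conj_y_mem_points_ideal[OF assms(2)]] assms(1) by auto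
  have P: "(\<Prod>P\<leftarrow>replicate k (p, q). x_minus (fst P)) = [:[:-p, 1:] ^ k:]"
    by (simp only: map_replicate prod_list_replicate fst_conv x_minus_power)
  \<comment> \<open>With the cofactor in normal form, comparing the coefficients of 1 turns
    divisibility on E into divisibility in \<open>K[x]\<close>.\<close>
  obtain l0 l1 where l01: "curve_eq f dvd l - [:l0, l1:]" using curve_eq_reduce by blast
  have "curve_eq f dvd ([:h0, h1:] * conj_y [:h0, h1:] - [:curve_norm f h0 h1:])
     - ([:h0, h1:] * conj_y [:h0, h1:] - [:[:-p, 1:] ^ k:] * l)
     - [:[:-p, 1:] ^ k:] * (l - [:l0, l1:])"
    by (intro dvd_diff mult_conj_y_curve_norm l[unfolded P] dvd_mult l01)
  also have "\<dots> = [:[:-p, 1:] ^ k * l0 - curve_norm f h0 h1, [:-p, 1:] ^ k * l1:]"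
    by (simp add: smult_diff_right conj_y_linear)
  finally have "curve_norm f h0 h1 = [:-p, 1:] ^ k * l0" by (simp only: curve_eq_dvd_linear_iff) simp
  then show ?thesis by (rule dvdI)
qed

section \<open>Miller functions\<close>

text \<open>The ideal \<open>I\<close> is generated by an element of least degree; if this were not
  constant, it would have a root, common to all of \<open>I\<close>.\<close>

lemma one_mem_of_no_common_root:
  fixes I :: "'a::alg_closed_field poly set"
  assumes add: "\<And>g h. g \<in> I \<Longrightarrow> h \<in> I \<Longrightarrow> g + h \<in> I"
    and mult: "\<And>g r. g \<in> I \<Longrightarrow> r * g \<in> I"
    and no_root: "\<And>\<alpha>. \<exists>g\<in>I. poly g \<alpha> \<noteq> 0"
  shows "1 \<in> I"
proof -
  obtain g0 where g0: "g0 \<in> I" "poly g0 0 \<noteq> 0" using no_root[of 0] by blast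
  then have "g0 \<noteq> 0" by auto
  with g0(1) have "g0 \<in> I \<and> g0 \<noteq> 0" by blast
  then obtain d where d: "d \<in> I" "d \<noteq> 0" and
    min: "\<And>g. g \<in> I \<and> g \<noteq> 0 \<Longrightarrow> degree d \<le> degree g"
    using ex_has_least_nat[of "\<lambda>g. g \<in> I \<and> g \<noteq> 0" g0 degree] by auto
  have dvd: "d dvd g" if "g \<in> I" for g
  proof (rule ccontr)
    assume "\<not> d dvd g"
    then have "g mod d \<noteq> 0" by (simp add: mod_eq_0_iff_dvd)
    moreover have eq: "g mod d = g + (- (g div d)) * d"
      unfolding minus_div_mult_eq_mod[symmetric] by simp
    have "g mod d \<in> I" unfolding eq by (intro add mult that d(1))
    ultimately show False using min[of "g mod d"] degree_mod_less[OF d(2), of g] by simp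
  qed
  have "degree d = 0"
  proof (rule ccontr)
    assume "degree d \<noteq> 0"
    then obtain \<alpha> where "poly d \<alpha> = 0" using alg_closed_imp_poly_has_root[of d] by auto
    moreover obtain g where "g \<in> I" "poly g \<alpha> \<noteq> 0" using no_root by blast
    ultimately show False using dvd[of g] by (auto simp: dvd_def)
  qed
  then obtain c where c: "d = [:c:]" by (rule degree_eq_zeroE)
  have "[:inverse c:] * d = 1" using d(2) unfolding c by (simp flip: one_pCons)
  then show ?thesis using mult[OF d(1), of "[:inverse c:]"] by (simp only:)
qed

lemma not_dvd_of_rsquarefree:
  assumes "rsquarefree f"
  shows "\<not> [:-\<alpha>, 1:]\<^sup>2 dvd f"
proof -
  have "f \<noteq> 0" "order \<alpha> f \<le> 1" using assms by (auto simp: rsquarefree_def le_Suc_eq)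
  then show ?thesis unfolding order_divides by simp
qed

text \<open>Ideal form of div(y - M) = P_1 + P_2 + P_3 - 3 O when y = M is a line. Two or three of
  the points may coincide, as for tangents and flexes, and then vanishing at each point is not
  enough.\<close>

lemma line_mem_points_ideal:
  fixes f M :: "'a::alg_closed_field poly"
  assumes sqf: "rsquarefree f" and two: "(2::'a) \<noteq> 0"
    and split: "f - M\<^sup>2 = [:-x1, 1:] * [:-x2, 1:] * [:-x3, 1:]"
  shows "[:- M, 1:] \<in> points_ideal (curve_eq f) [(x1, poly M x1), (x2, poly M x2), (x3, poly M x3)]"
    (is "?l \<in> ?Q")
proof -
  let ?F = "curve_eq f"
  have F0: "eval2 ?F x (poly M x) = 0" if "poly (f - M\<^sup>2) x = 0" for x
    using that by (simp add: curve_eq_def eval2_def power2_eq_square)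
  have X: "x_minus x \<in> points_ideal ?F [(x, poly M x)]"
    and L: "?l \<in> points_ideal ?F [(x, poly M x)]" if "poly (f - M\<^sup>2) x = 0" for x
    using F0[OF that] by (simp_all add: mem_points_ideal_iff_eval2 eval2_linear)
  have r: "poly (f - M\<^sup>2) x1 = 0" "poly (f - M\<^sup>2) x2 = 0" "poly (f - M\<^sup>2) x3 = 0"
    unfolding split by (simp_all del: mult_pCons_left mult_pCons_right)
  have prod: "u1 * u2 * u3 \<in> ?Q" if "u1 \<in> points_ideal ?F [(x1, poly M x1)]"
    "u2 \<in> points_ideal ?F [(x2, poly M x2)]" "u3 \<in> points_ideal ?F [(x3, poly M x3)]" for u1 u2 u3
    using points_ideal_append[OF points_ideal_append[OF that(1,2)] that(3)] by simp
  have Xc: "[:[:-x, 1:] * [:-y, 1:]:] = x_minus x * x_minus y" for x y :: 'a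
    by (simp add: x_minus_def)
  define XXX where "XXX = x_minus x1 * x_minus x2 * x_minus x3"
  have XXX: "XXX = [:f - M\<^sup>2:]" unfolding split XXX_def by (simp add: x_minus_def)
  \<comment> \<open>For l = y - M this is l (l + 2 M) = y^2 - M^2 = (y^2 - f) + (f - M^2).\<close>
  have rel: "?l * ?l + [:2 * M:] * ?l = ?F + XXX"
    unfolding XXX by (simp add: curve_eq_def power2_eq_square)
  \<comment> \<open>The multipliers of \<open>l = y - M\<close> into \<open>Q\<close> include \<open>4 M\<^sup>2\<close> and all \<open>(x - x\<^sub>i) (x - x\<^sub>j)\<close>, \<open>i \<noteq> j\<close>;
    a common root of these would be a double root of \<open>f\<close>.\<close>
  define I where "I = {h. [:h:] * ?l \<in> ?Q}"
  have "1 \<in> I"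
  proof (rule one_mem_of_no_common_root)
    fix g h assume "g \<in> I" "h \<in> I"
    then have "[:g:] * ?l + [:h:] * ?l \<in> ?Q" unfolding I_def by (simp only: mem_Collect_eq points_ideal_add)
    then show "g + h \<in> I" unfolding I_def mem_Collect_eq by (simp only: distrib_right[symmetric]) simp
  next
    fix g r assume "g \<in> I"
    then have "[:r:] * ([:g:] * ?l) \<in> ?Q" unfolding I_def by (simp only: mem_Collect_eq points_ideal_mult)
    moreover have "[:r * g:] = [:r:] * [:g:]" by simp
    ultimately show "r * g \<in> I" unfolding I_def mem_Collect_eq by (simp only: mult.assoc)
  next
    fix \<alpha>
    have "[:-x1, 1:] * [:-x2, 1:] \<in> I" "[:-x1, 1:] * [:-x3, 1:] \<in> I" "[:-x2, 1:] * [:-x3, 1:] \<in> I"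
      using prod[OF X[OF r(1)] X[OF r(2)] L[OF r(3)]] prod[OF X[OF r(1)] L[OF r(2)] X[OF r(3)]]
        prod[OF L[OF r(1)] X[OF r(2)] X[OF r(3)]]
      unfolding I_def mem_Collect_eq Xc by (simp_all only: ac_simps)
    \<comment> \<open>Replacing 2 M l twice by means of \<open>rel\<close> leaves l^3 and multiples
      of \<open>F\<close> and \<open>XXX\<close>, all of which lie in Q.\<close>
    moreover have "(2 * M)\<^sup>2 \<in> I"
    proof -
      have XQ: "XXX \<in> ?Q" unfolding XXX_def by (intro prod X r)
      have LQ: "?l * ?l * ?l \<in> ?Q" by (intro prod L r)
      have rel': "[:2 * M:] * ?l = (?F + XXX) - ?l * ?l" using rel by (simp only: eq_diff_eq add.commute)
      have "[:(2 * M)\<^sup>2:] * ?l = [:2 * M:] * ([:2 * M:] * ?l)" by (simp add: power2_eq_square)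
      also have "\<dots> = [:2 * M:] * (?F + XXX) - ?l * ([:2 * M:] * ?l)"
        by (subst rel') (simp only: right_diff_distrib ac_simps)
      also have "\<dots> = [:2 * M:] * (?F + XXX) - (?l * (?F + XXX) - ?l * ?l * ?l)"
        unfolding rel' by (simp only: right_diff_distrib ac_simps)
      also have "\<dots> \<in> ?Q"
        using points_ideal_modulus[of ?F 1] XQ LQ
        by (intro points_ideal_diff points_ideal_mult[where r = "[:2 * M:]"]
            points_ideal_mult[where r = ?l] points_ideal_add) simp_all
      finally show ?thesis unfolding I_def by simp
    qed
    moreover have "poly ((2 * M)\<^sup>2) \<alpha> \<noteq> 0"
      if two_roots: "\<alpha> = x1 \<and> \<alpha> = x2 \<or> \<alpha> = x1 \<and> \<alpha> = x3 \<or> \<alpha> = x2 \<and> \<alpha> = x3"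
    proof
      assume "poly ((2 * M)\<^sup>2) \<alpha> = 0"
      moreover have "poly ((2 * M)\<^sup>2) \<alpha> = 2 * 2 * (poly M \<alpha>)\<^sup>2" by simp
      ultimately have "poly M \<alpha> = 0" using two by (metis mult_eq_0_iff power_eq_0_iff)
      then have "[:-\<alpha>, 1:] dvd M" by (simp add: poly_eq_0_iff_dvd)
      then have "[:-\<alpha>, 1:]\<^sup>2 dvd M\<^sup>2" by (rule dvd_power_same)
      moreover have "[:-\<alpha>, 1:]\<^sup>2 dvd f - M\<^sup>2"
        using two_roots unfolding split power2_eq_square[of "[:-\<alpha>, 1:]"]
        by (elim disjE conjE) (simp_all only: mult_dvd_mono dvd_refl dvd_triv_left dvd_triv_right)
      ultimately have "[:-\<alpha>, 1:]\<^sup>2 dvd f" using dvd_add[of _ "f - M\<^sup>2" "M\<^sup>2"] by simp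
      then show False using not_dvd_of_rsquarefree[OF sqf] by blast
    qed
    moreover have "poly ([:-x1, 1:] * [:-x2, 1:]) \<alpha> \<noteq> 0 \<or> poly ([:-x1, 1:] * [:-x3, 1:]) \<alpha> \<noteq> 0 \<or>
      poly ([:-x2, 1:] * [:-x3, 1:]) \<alpha> \<noteq> 0"
      if "\<not> (\<alpha> = x1 \<and> \<alpha> = x2 \<or> \<alpha> = x1 \<and> \<alpha> = x3 \<or> \<alpha> = x2 \<and> \<alpha> = x3)"
      using that by (auto simp del: mult_pCons_left mult_pCons_right)
    ultimately show "\<exists>g\<in>I. poly g \<alpha> \<noteq> 0" by blast
  qed
  then show ?thesis unfolding I_def by simp
qed

text \<open>Ideal form of div(x - p) = P + (-P) - 2 O. If q is nonzero, then (x - p)(y + q) - (y -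
  q)(x - p) = 2 q (x - p). If q = 0, then y^2 = f = (x - p) \<phi> on E with \<phi>(p) nonzero, as p
  is a simple root, and subtracting a multiple of (x - p)^2 leaves \<phi>(p) (x - p).\<close>

lemma x_minus_mem_points_ideal:
  fixes f :: "'a::field poly"
  assumes sqf: "rsquarefree f" and two: "(2::'a) \<noteq> 0" and on: "q\<^sup>2 = poly f p"
  shows "x_minus p \<in> points_ideal (curve_eq f) [(p, q), (p, - q)]" (is "_ \<in> ?Q")
proof -
  let ?F = "curve_eq f"
  have F0: "eval2 ?F p q = 0" "eval2 ?F p (- q) = 0"
    using on by (simp_all add: curve_eq_def eval2_def power2_eq_square)
  have prod: "u1 * u2 \<in> ?Q" if "eval2 u1 p q = 0" "eval2 u2 p (-q) = 0" for u1 u2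
    using that F0 points_ideal_append[of u1 ?F "[(p, q)]" u2 "[(p, - q)]"]
    by (simp add: mem_points_ideal_iff_eval2)
  have unit: "x_minus p \<in> ?Q" if "[:[:c:]:] * x_minus p \<in> ?Q" "c \<noteq> 0" for c
  proof -
    have "[:[:inverse c:]:] * ([:[:c:]:] * x_minus p) \<in> ?Q" by (rule points_ideal_mult[OF that(1)])
    then show ?thesis using that(2) unfolding mult.assoc[symmetric] by (simp add: one_pCons[symmetric])
  qed
  show ?thesis
  proof (cases "q = 0")
    case False
    have "x_minus p * y_minus (- q) - y_minus q * x_minus p \<in> ?Q"
      by (intro points_ideal_diff prod) simp_all
    also have "x_minus p * y_minus (- q) - y_minus q * x_minus p = [:[:2 * q:]:] * x_minus p"
      by (simp add: x_minus_def y_minus_def)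
    finally show ?thesis by (rule unit) (use False two in simp)
  next
    case True
    have "[:-p, 1:] dvd f" using on True by (simp add: poly_eq_0_iff_dvd)
    then obtain \<phi> where \<phi>: "f = [:-p, 1:] * \<phi>" by (rule dvdE)
    have \<phi>_nz: "poly \<phi> p \<noteq> 0"
    proof
      assume "poly \<phi> p = 0"
      then have "[:-p, 1:] dvd \<phi>" by (simp add: poly_eq_0_iff_dvd)
      then have "[:-p, 1:]\<^sup>2 dvd f" unfolding \<phi> power2_eq_square by (rule mult_dvd_mono[OF dvd_refl])
      with not_dvd_of_rsquarefree[OF sqf] show False by blast
    qed
    have "[:-p, 1:] dvd \<phi> - [:poly \<phi> p:]" by (simp add: poly_eq_0_iff_dvd[symmetric])
    then obtain \<psi> where \<psi>: "\<phi> - [:poly \<phi> p:] = [:-p, 1:] * \<psi>" by (rule dvdE)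
    have "y_minus q * y_minus (-q) - ?F * 1 - [:\<psi>:] * (x_minus p * x_minus p) \<in> ?Q"
      by (intro points_ideal_diff points_ideal_modulus points_ideal_mult prod) simp_all
    also have "y_minus q * y_minus (-q) - ?F * 1 - [:\<psi>:] * (x_minus p * x_minus p)
      = [:f - [:-p, 1:] * ([:-p, 1:] * \<psi>):]"
      using True by (simp add: curve_eq_def x_minus_def y_minus_def mult.commute[of \<psi>] del: mult_pCons_left)
    also have "\<dots> = [:[:poly \<phi> p:]:] * x_minus p"
      unfolding \<psi>[symmetric] unfolding \<phi> by (simp only: right_diff_distrib) (simp add: x_minus_def)
    finally show ?thesis by (rule unit) (rule \<phi>_nz)
  qed
qed

text \<open>Division by x - p without fractions. After splitting off P and -P, only the product (y -
  q)(y + q) lacks a visible factor x - p, and it has one modulo the curve.\<close>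

lemma points_ideal_neg_pair:
  assumes on: "q\<^sup>2 = poly f p" and h: "h \<in> points_ideal (curve_eq f) ((p, q) # (p, - q) # Ps)"
  shows "\<exists>h'\<in>points_ideal (curve_eq f) Ps. curve_eq f dvd h - x_minus p * h'"
proof -
  let ?F = "curve_eq f" and ?X = "x_minus p" and ?Y = "y_minus q" and ?Z = "y_minus (- q)"
  obtain g1 g2 k where g: "g1 \<in> points_ideal ?F ((p, - q) # Ps)" "g2 \<in> points_ideal ?F ((p, - q) # Ps)"
    "h = ?X * g1 + ?Y * g2 + ?F * k"
    using h by (rule points_ideal_ConsE[where P = "(p, q)", unfolded fst_conv snd_conv])
  obtain u1 u2 l where u: "u1 \<in> points_ideal ?F Ps" "u2 \<in> points_ideal ?F Ps"
    "g2 = ?X * u1 + ?Z * u2 + ?F * l"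
    using g(2) by (rule points_ideal_ConsE[where P = "(p, - q)", unfolded fst_conv snd_conv])
  obtain w where w: "?Y * ?Z = ?F + ?X * [:w:]" using y_minus_mult_conj[OF on] by blast
  have "h = ?X * g1 + (?X * (?Y * u1) + (?Y * ?Z) * u2 + ?F * (l * ?Y)) + ?F * k"
    unfolding g(3) u(3) by (simp only: ring_distribs ac_simps)
  also have "\<dots> = ?X * (g1 + ?Y * u1 + [:w:] * u2) + ?F * (u2 + l * ?Y + k)"
    unfolding w by (simp only: ring_distribs ac_simps)
  finally have "h - ?X * (g1 + ?Y * u1 + [:w:] * u2) = ?F * (u2 + l * ?Y + k)"
    by (simp only: add_diff_cancel_left')
  then have "?F dvd h - ?X * (g1 + ?Y * u1 + [:w:] * u2)" by (rule dvdI)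
  moreover have "g1 + ?Y * u1 + [:w:] * u2 \<in> points_ideal ?F Ps"
    by (intro points_ideal_add points_ideal_mult u subsetD[OF points_ideal_Cons_subset g(1)])
  ultimately show ?thesis by blast
qed

lemma diff_rearrange:
  fixes u k x h g :: "'a::comm_ring_1"
  shows "(u - x * h) - (u - k) + x * (h - g) = k - x * g"
  by (simp add: algebra_simps)

text \<open>Brahmagupta's identity, i.e. multiplicativity of the norm: the squares on the left are
  those of the coefficients of (g0 + g1 y)(h0 + h1 y) on E.\<close>

lemma norm_form_mult:
  fixes g0 g1 h0 h1 f :: "'a::comm_ring_1"
  shows "(g0 * h0 + g1 * h1 * f)\<^sup>2 - (g0 * h1 + g1 * h0)\<^sup>2 * f = (g0\<^sup>2 - g1\<^sup>2 * f) * (h0\<^sup>2 - h1\<^sup>2 * f)"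
  by (simp add: power2_eq_square algebra_simps)

text \<open>
  If $g$ has divisor $mT + (-R) - (m + 1) O$ and $M$ is the line through $T$, $R$ and $S = -(T + R)$,
  then $g \cdot (y - M) / (x - x_R)$ has divisor $(m + 1) T + S - (m + 2) O$.
\<close>

lemma miller_step:
  fixes f M :: "'a::alg_closed_field poly"
  assumes sqf: "rsquarefree f" and two: "(2::'a) \<noteq> 0"
    and split: "f - M\<^sup>2 = [:-xT, 1:] * [:-x1, 1:] * [:-x3, 1:]"
    and M: "poly M xT = yT" "poly M x1 = y1"
    and g: "[:g0, g1:] \<in> points_ideal (curve_eq f) ((x1, - y1) # replicate m (xT, yT))"
    and N: "curve_norm f g0 g1 \<noteq> 0" "degree (curve_norm f g0 g1) = d"
  shows "\<exists>h0 h1. [:h0, h1:] \<in> points_ideal (curve_eq f) ((x3, poly M x3) # replicate (Suc m) (xT, yT)) \<and>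
    curve_norm f h0 h1 \<noteq> 0 \<and> degree (curve_norm f h0 h1) = Suc d"
proof -
  let ?F = "curve_eq f"
  have on: "y1\<^sup>2 = poly f x1"
  proof -
    have "poly (f - M\<^sup>2) x1 = 0" unfolding split by (simp del: mult_pCons_left mult_pCons_right)
    then show ?thesis using M by simp
  qed
  have "[:g0, g1:] * [:- M, 1:]
      \<in> points_ideal ?F (((x1, - y1) # replicate m (xT, yT)) @ [(xT, yT), (x1, y1), (x3, poly M x3)])"
    using points_ideal_append[OF g line_mem_points_ideal[OF sqf two split]] unfolding M .
  \<comment> \<open>R and -R come to the front to be cancelled against x - x_R; the copy of T on the
    line joins the \<open>m\<close> others.\<close>
  also have "\<dots> \<subseteq> points_ideal ?F ((x1, y1) # (x1, - y1) # (x3, poly M x3) # replicate (Suc m) (xT, yT))"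
    by (rule points_ideal_mset) simp
  finally obtain h where h: "h \<in> points_ideal ?F ((x3, poly M x3) # replicate (Suc m) (xT, yT))"
    "?F dvd [:g0, g1:] * [:- M, 1:] - x_minus x1 * h"
    using points_ideal_neg_pair[OF on] by blast
  obtain h0 h1 where h01: "?F dvd h - [:h0, h1:]" using curve_eq_reduce by blast
  have mem: "[:h0, h1:] \<in> points_ideal ?F ((x3, poly M x3) # replicate (Suc m) (xT, yT))"
    using points_ideal_cong[OF h01] h(1) by blast
  \<comment> \<open>The normal form of g (y - M) on E, with the factor 1 kept so that it matches
    \<open>norm_form_mult\<close>.\<close>
  define k0 k1 where "k0 = g0 * (- M) + g1 * 1 * f" and "k1 = g0 * 1 + g1 * (- M)"
  have 1: "[:g0, g1:] * [:- M, 1:] - [:k0, k1:] = ?F * [:g1:]"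
    by (simp add: curve_eq_def k0_def k1_def)
  have "?F dvd ([:g0, g1:] * [:- M, 1:] - x_minus x1 * h)
      - ([:g0, g1:] * [:- M, 1:] - [:k0, k1:]) + x_minus x1 * (h - [:h0, h1:])"
    unfolding 1 by (intro dvd_add dvd_diff h(2) dvd_mult h01 dvd_triv_left)
  also have "\<dots> = [:k0, k1:] - x_minus x1 * [:h0, h1:]"
    by (rule diff_rearrange)
  also have "\<dots> = [:k0 - [:-x1, 1:] * h0, k1 - [:-x1, 1:] * h1:]"
    by (simp add: x_minus_def)
  finally have k: "k0 = [:-x1, 1:] * h0" "k1 = [:-x1, 1:] * h1"
    unfolding curve_eq_dvd_linear_iff by (simp_all only: right_minus_eq)
  \<comment> \<open>The norm of k = (x - x1) h is computed in two ways: x - x1 contributes its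
    square, and y - M contributes minus the three linear factors of f - M^2. Comparing degrees gives
    2 + deg N(h) = d + 3.\<close>
  have "curve_norm f k0 k1 = curve_norm f g0 g1 * curve_norm f (- M) 1"
    unfolding k0_def k1_def curve_norm_def by (rule norm_form_mult)
  also have "curve_norm f (- M) 1 = - (f - M\<^sup>2)" by (simp add: curve_norm_def)
  also have "curve_norm f k0 k1 = [:-x1, 1:]\<^sup>2 * curve_norm f h0 h1"
    unfolding k curve_norm_def power_mult_distrib right_diff_distrib by (simp only: mult.assoc)
  finally have eq: "[:-x1, 1:]\<^sup>2 * curve_norm f h0 h1
      = curve_norm f g0 g1 * - ([:-xT, 1:] * [:-x1, 1:] * [:-x3, 1:])"
    unfolding split .
  have nz: "[:-x, 1:] \<noteq> 0" for x :: 'a by simp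
  have ne: "curve_norm f h0 h1 \<noteq> 0"
  proof
    assume "curve_norm f h0 h1 = 0"
    with eq N(1) nz show False by (simp del: mult_pCons_left mult_pCons_right)
  qed
  have "degree ([:-x1, 1:]\<^sup>2 * curve_norm f h0 h1) = 2 + degree (curve_norm f h0 h1)"
    using ne by (subst degree_mult_eq) (simp_all add: degree_linear_power)
  moreover have "degree (curve_norm f g0 g1 * - ([:-xT, 1:] * [:-x1, 1:] * [:-x3, 1:])) = d + 3"
  proof -
    have "degree ([:-xT, 1:] * [:-x1, 1:] * [:-x3, 1:]) = 3"
      using nz by (simp add: degree_mult_eq del: mult_pCons_left mult_pCons_right)
    moreover have "- ([:-xT, 1:] * [:-x1, 1:] * [:-x3, 1:]) \<noteq> 0" using nz
      by (simp del: mult_pCons_left mult_pCons_right)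
    ultimately show ?thesis
      using N by (subst degree_mult_eq) (auto simp del: mult_pCons_left mult_pCons_right)
  qed
  ultimately have "degree (curve_norm f h0 h1) = Suc d" unfolding eq by simp
  with mem ne show ?thesis by blast
qed

text \<open>The point (x3, - y3) is the third intersection of E with the chord or tangent, whence
  the sign in the last equation. The formula for x3 is Vieta's formula for the sum of the roots of f
  - M^2.\<close>

lemma ec_add_line:
  fixes a b c :: "'a::field"
  assumes two: "(2::'a) \<noteq> 0" and f: "f = cubic a b c"
    and on: "y1\<^sup>2 = poly f x1" "y2\<^sup>2 = poly f x2"
    and sum: "ec_add a b (Aff x1 y1) (Aff x2 y2) = Aff x3 y3"
  shows "\<exists>M. f - M\<^sup>2 = [:-x1, 1:] * [:-x2, 1:] * [:-x3, 1:] \<and>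
    poly M x1 = y1 \<and> poly M x2 = y2 \<and> poly M x3 = - y3"
proof -
  have nopp: "\<not> (x1 = x2 \<and> y1 = - y2)" using sum by auto
  define l where "l = (if x1 = x2 then (3 * x1\<^sup>2 + 2 * a * x1 + b) / (2 * y1) else (y2 - y1) / (x2 - x1))"
  have x3: "x3 = l\<^sup>2 - a - x1 - x2" and y3: "y3 = l * (x1 - x3) - y1"
    using sum nopp by (auto simp: l_def Let_def)
  have on1: "y1\<^sup>2 = x1 ^ 3 + a * x1\<^sup>2 + b * x1 + c" and on2: "y2\<^sup>2 = x2 ^ 3 + a * x2\<^sup>2 + b * x2 + c"
    using on unfolding f cubic_def by (simp_all add: power2_eq_square power3_eq_cube algebra_simps)
  \<comment> \<open>The second equation says that l (y1 + y2) is the divided difference of f at x1,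
    x2, written as a polynomial. It holds for chords and tangents alike, so the two cases are
    separated only here.\<close>
  have K: "y2 = y1 + l * (x2 - x1) \<and>
      x2\<^sup>2 + x1 * x2 + x1\<^sup>2 + a * (x1 + x2) + b = l * (2 * y1 + l * (x2 - x1))"
  proof (cases "x1 = x2")
    case True
    then have "y1\<^sup>2 = y2\<^sup>2" using on by simp
    then have y: "y1 = y2" "y1 \<noteq> 0" using nopp True by (auto simp: power2_eq_iff)
    then have "l * (2 * y1) = 3 * x1\<^sup>2 + 2 * a * x1 + b" using True two by (simp add: l_def)
    then show ?thesis using True y by (simp add: power2_eq_square algebra_simps)
  next
    case False
    then have l: "l * (x2 - x1) = y2 - y1" by (simp add: l_def)
    have "(x2 - x1) * (x2\<^sup>2 + x1 * x2 + x1\<^sup>2 + a * (x1 + x2) + b)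
        = (x2 - x1) * (l * (2 * y1 + l * (x2 - x1)))"
      using l on1 on2 by algebra
    then show ?thesis using False l by simp
  qed
  \<comment> \<open>The intercept of the line; \<open>e1\<close>, \<open>e2\<close>,
    \<open>e3\<close> are Vieta's formulas for f - M^2.\<close>
  define \<nu> where "\<nu> = y1 - l * x1"
  have e2: "b - 2 * l * \<nu> = x1 * x2 + (x1 + x2) * x3"
    using K unfolding x3 \<nu>_def by algebra
  have e1: "c - \<nu>\<^sup>2 = - x1 * x2 * x3"
    using e2 on1 unfolding x3 \<nu>_def by algebra
  have e3: "a - l\<^sup>2 = - (x1 + x2 + x3)" unfolding x3 by simp
  have M: "f - [:\<nu>, l:]\<^sup>2 = [:-x1, 1:] * [:-x2, 1:] * [:-x3, 1:]"
  proof -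
    have "f - [:\<nu>, l:]\<^sup>2 = [:c - \<nu>\<^sup>2, b - 2 * l * \<nu>, a - l\<^sup>2, 1:]"
      unfolding f cubic_def power2_eq_square by simp
    also have "\<dots> = [:-x1, 1:] * [:-x2, 1:] * [:-x3, 1:]"
      unfolding e1 e2 e3 by (simp, simp add: algebra_simps)
    finally show ?thesis .
  qed
  moreover have "poly [:\<nu>, l:] x1 = y1" "poly [:\<nu>, l:] x2 = y2" "poly [:\<nu>, l:] x3 = - y3"
    using K unfolding \<nu>_def y3 by (simp_all add: algebra_simps)
  ultimately show ?thesis by blast
qed

lemma ec_mult_Suc: "ec_mult a b (Suc m) P = ec_add a b P (ec_mult a b m P)"
  by (simp add: ec_mult_def)

text \<open>The invariant of the recursion: for R = (m + 1) T there is a function with divisor (m +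
  1) T + (-R) - (m + 2) O. The index is shifted so that it starts at R = T, with x - x_T.\<close>

lemma miller_function:
  fixes a b c xT yT :: "'a::alg_closed_field"
  assumes f: "f = cubic a b c" and sqf: "rsquarefree f" and two: "(2::'a) \<noteq> 0"
    and on: "yT\<^sup>2 = poly f xT"
    and nz: "\<And>k. 0 < k \<Longrightarrow> k \<le> Suc m \<Longrightarrow> ec_mult a b k (Aff xT yT) \<noteq> Inf"
  shows "\<exists>x1 y1 g0 g1. ec_mult a b (Suc m) (Aff xT yT) = Aff x1 y1 \<and> y1\<^sup>2 = poly f x1 \<and>
    [:g0, g1:] \<in> points_ideal (curve_eq f) ((x1, - y1) # replicate (Suc m) (xT, yT)) \<and>
    curve_norm f g0 g1 \<noteq> 0 \<and> degree (curve_norm f g0 g1) = Suc (Suc m)"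
  using nz
proof (induction m)
  case 0
  have "[:[:- xT, 1:], 0:] \<in> points_ideal (curve_eq f) [(xT, - yT), (xT, yT)]"
    using subsetD[OF points_ideal_swap x_minus_mem_points_ideal[OF sqf two on]]
    by (simp add: x_minus_def)
  moreover have "curve_norm f [:- xT, 1:] 0 = [:- xT, 1:] ^ 2" by (simp add: curve_norm_def)
  moreover have "ec_mult a b (Suc 0) (Aff xT yT) = Aff xT yT" by (simp add: ec_mult_def)
  ultimately show ?case using on
    by (intro exI[of _ xT] exI[of _ yT] exI[of _ "[:- xT, 1:]"] exI[of _ 0])
      (simp add: degree_linear_power del: mult_pCons_left mult_pCons_right)
next
  case (Suc m)
  then obtain x1 y1 g0 g1 where R: "ec_mult a b (Suc m) (Aff xT yT) = Aff x1 y1" "y1\<^sup>2 = poly f x1"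
    and g: "[:g0, g1:] \<in> points_ideal (curve_eq f) ((x1, - y1) # replicate (Suc m) (xT, yT))"
      "curve_norm f g0 g1 \<noteq> 0" "degree (curve_norm f g0 g1) = Suc (Suc m)"
    by (metis le_Suc_eq)
  have "ec_mult a b (Suc (Suc m)) (Aff xT yT) \<noteq> Inf" using Suc.prems by simp
  then obtain x3 y3 where S: "ec_mult a b (Suc (Suc m)) (Aff xT yT) = Aff x3 y3"
    by (cases "ec_mult a b (Suc (Suc m)) (Aff xT yT)") auto
  then have "ec_add a b (Aff xT yT) (Aff x1 y1) = Aff x3 y3" using R by (simp add: ec_mult_Suc)
  from ec_add_line[OF two f on R(2) this] obtain M
    where M: "f - M\<^sup>2 = [:-xT, 1:] * [:-x1, 1:] * [:-x3, 1:]" "poly M xT = yT" "poly M x1 = y1"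
      "poly M x3 = - y3" by blast
  have "poly (f - M\<^sup>2) x3 = 0" unfolding M(1) by (simp del: mult_pCons_left mult_pCons_right)
  then have "y3\<^sup>2 = poly f x3" using M(4) by simp
  with S miller_step[OF sqf two M(1-3) g] M(4) show ?case by metis
qed

lemma exists_torsion_function:
  fixes a b c xT yT :: "'a::alg_closed_field"
  assumes f: "f = cubic a b c" and sqf: "rsquarefree f" and two: "(2::'a) \<noteq> 0"
    and on: "yT\<^sup>2 = poly f xT" and n: "n \<ge> 2" and ord: "ec_has_order a b (Aff xT yT) n"
  shows "\<exists>g0 g1. [:g0, g1:] \<in> points_ideal (curve_eq f) (replicate n (xT, yT)) \<and>
    curve_norm f g0 g1 \<noteq> 0 \<and> degree (curve_norm f g0 g1) = n"
proof -
  obtain m where m: "n = Suc (Suc m)" using n by (metis le_Suc_ex add_2_eq_Suc)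
  obtain x1 y1 g0 g1 where R: "ec_mult a b (Suc m) (Aff xT yT) = Aff x1 y1" "y1\<^sup>2 = poly f x1"
    and g: "[:g0, g1:] \<in> points_ideal (curve_eq f) ((x1, - y1) # replicate (Suc m) (xT, yT))"
      "curve_norm f g0 g1 \<noteq> 0" "degree (curve_norm f g0 g1) = Suc (Suc m)"
    using miller_function[OF f sqf two on, of m] ord unfolding ec_has_order_def m by auto
  have "ec_add a b (Aff xT yT) (Aff x1 y1) = Inf"
    using ord R unfolding ec_has_order_def m ec_mult_Suc by simp
  \<comment> \<open>As T + R = O for R = (n - 1) T, the extra zero -R is an n-th copy of T.\<close>
  then have "x1 = xT" "- y1 = yT" by (auto simp: Let_def split: if_splits)
  with g m show ?thesis by auto
qed

section \<open>Leading terms and reduced Groebner bases\<close>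

lemma gt2_trans: "e1 >\<^sub>2 e2 \<Longrightarrow> e2 >\<^sub>2 e3 \<Longrightarrow> e1 >\<^sub>2 e3"
  unfolding gt2_def by auto

lemma gt2_irrefl: "\<not> e >\<^sub>2 e"
  unfolding gt2_def by auto

lemma gt2_asym: "e1 >\<^sub>2 e2 \<Longrightarrow> \<not> e2 >\<^sub>2 e1"
  unfolding gt2_def by auto

lemma gt2_total: "e1 \<noteq> e2 \<Longrightarrow> e1 >\<^sub>2 e2 \<or> e2 >\<^sub>2 e1"
  unfolding gt2_def wdeg_def by (cases e1; cases e2) auto

lemma gt2_of_le: "fst d \<le> fst e \<Longrightarrow> snd d \<le> snd e \<Longrightarrow> d = e \<or> e >\<^sub>2 d"
  unfolding gt2_def wdeg_def by (cases d; cases e) auto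

lemma gt2_imp_wdeg_le: "e1 >\<^sub>2 e2 \<Longrightarrow> wdeg e2 \<le> wdeg e1"
  unfolding gt2_def by auto

lemma finite_supp2: "finite (supp2 h)"
proof -
  have "supp2 h \<subseteq> (\<Union>m\<le>degree h. {m} \<times> {..degree (coeff h m)})"
  proof
    fix e assume "e \<in> supp2 h"
    then have e: "coeff (coeff h (fst e)) (snd e) \<noteq> 0" by (simp add: supp2_def coeff2_def)
    then have "coeff h (fst e) \<noteq> 0" by auto
    with e show "e \<in> (\<Union>m\<le>degree h. {m} \<times> {..degree (coeff h m)})"
      by (cases e) (auto intro: le_degree)
  qed
  then show ?thesis by (rule finite_subset) auto
qed

lemma supp2_eq_empty_iff: "supp2 h = {} \<longleftrightarrow> h = 0"
  by (auto simp: supp2_def coeff2_def poly_eq_iff)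

lemma finite_gt2_greatest:
  assumes "finite S" "S \<noteq> {}"
  shows "\<exists>e\<in>S. \<forall>e'\<in>S. e' \<noteq> e \<longrightarrow> e >\<^sub>2 e'"
  using assms
proof (induction rule: finite_ne_induct)
  case (insert x S)
  then obtain e where e: "e \<in> S" "\<forall>e'\<in>S. e' \<noteq> e \<longrightarrow> e >\<^sub>2 e'" by blast
  have "x \<noteq> e" using insert e by auto
  then consider "x >\<^sub>2 e" | "e >\<^sub>2 x" using gt2_total by blast
  then show ?case
  proof cases
    case 1
    then have "\<forall>e'\<in>S. x >\<^sub>2 e'" using e gt2_trans by metis
    then show ?thesis by auto
  next
    case 2
    then show ?thesis using e by auto
  qed
qed auto

lemma multideg_props:
  assumes "h \<noteq> 0"
  shows multideg_mem_supp2: "multideg h \<in> supp2 h"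
    and multideg_greatest: "e \<in> supp2 h \<Longrightarrow> e \<noteq> multideg h \<Longrightarrow> multideg h >\<^sub>2 e"
proof -
  have "\<exists>e\<in>supp2 h. \<forall>e'\<in>supp2 h. e' \<noteq> e \<longrightarrow> e >\<^sub>2 e'"
    using assms by (intro finite_gt2_greatest finite_supp2) (simp add: supp2_eq_empty_iff)
  then obtain m where e: "m \<in> supp2 h" "\<And>e'. e' \<in> supp2 h \<Longrightarrow> e' \<noteq> m \<Longrightarrow> m >\<^sub>2 e'"
    by blast
  have "\<exists>!e. e \<in> supp2 h \<and> (\<forall>e'\<in>supp2 h. e' \<noteq> e \<longrightarrow> e >\<^sub>2 e')"
  proof (rule ex1I[of _ m])
    fix d assume d: "d \<in> supp2 h \<and> (\<forall>e'\<in>supp2 h. e' \<noteq> d \<longrightarrow> d >\<^sub>2 e')"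
    show "d = m"
    proof (rule ccontr)
      assume "d \<noteq> m"
      then have "m >\<^sub>2 d" "d >\<^sub>2 m" using e d by auto
      then show False using gt2_asym by blast
    qed
  qed (use e in blast)
  from theI'[OF this] have "multideg h \<in> supp2 h \<and>
      (\<forall>e'\<in>supp2 h. e' \<noteq> multideg h \<longrightarrow> multideg h >\<^sub>2 e')"
    unfolding multideg_def .
  then show "multideg h \<in> supp2 h"
    "e \<in> supp2 h \<Longrightarrow> e \<noteq> multideg h \<Longrightarrow> multideg h >\<^sub>2 e"
    by blast+
qed

lemma multideg_eqI:
  assumes "e \<in> supp2 h" "\<And>e'. e' \<in> supp2 h \<Longrightarrow> e' \<noteq> e \<Longrightarrow> e >\<^sub>2 e'"
  shows "multideg h = e"
proof -
  have "h \<noteq> 0" using assms(1) supp2_eq_empty_iff by auto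
  then have "e = multideg h \<or> multideg h >\<^sub>2 e" "multideg h = e \<or> e >\<^sub>2 multideg h"
    using multideg_mem_supp2[of h] multideg_greatest[of h e] assms by blast+
  then show ?thesis using gt2_asym by blast
qed

section \<open>Monomial ideals\<close>

lemma coeff2_term2: "coeff2 (term2 c e) e' = (if e' = e then c else 0)"
  by (cases e; cases e') (auto simp: coeff2_def term2_def)

lemma term2_mult: "term2 c d * term2 c' d' = term2 (c * c') (fst d + fst d', snd d + snd d')"
  by (simp add: term2_def mult_monom)

lemma lead_coeff2_nonzero: "h \<noteq> 0 \<Longrightarrow> lead_coeff2 h \<noteq> 0"
  using multideg_mem_supp2[of h] by (simp add: lead_coeff2_def supp2_def)

lemma supp2_mult:
  fixes g h :: "'a::comm_ring_1 poly poly"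
  assumes "e \<in> supp2 (g * h)"
  shows "\<exists>d\<in>supp2 h. fst d \<le> fst e \<and> snd d \<le> snd e"
proof (rule ccontr)
  assume *: "\<not> ?thesis"
  have "coeff (coeff (g * h) (fst e)) (snd e)
      = (\<Sum>i\<le>fst e. \<Sum>j\<le>snd e. coeff (coeff g i) j * coeff (coeff h (fst e - i)) (snd e - j))"
    by (simp add: coeff_mult coeff_sum)
  also have "\<dots> = 0"
  proof (intro sum.neutral ballI)
    fix i j
    have "(fst e - i, snd e - j) \<notin> supp2 h" using * by force
    then show "coeff (coeff g i) j * coeff (coeff h (fst e - i)) (snd e - j) = 0"
      by (simp add: supp2_def coeff2_def)
  qed
  finally show False using assms by (simp add: supp2_def coeff2_def)
qed

text \<open>The polynomials all of whose monomials are divisible by a leading monomial from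
  \<open>S\<close> form an ideal, and it contains the leading terms. An element 0 of
  \<open>S\<close> does no harm, its leading term being 0.\<close>

lemma supp2_mem_monomial_ideal:
  fixes h :: "'a::comm_ring_1 poly poly"
  assumes "h \<in> ideal_gen (lead_term2 ` S)" "e \<in> supp2 h"
  shows "\<exists>g\<in>S. fst (multideg g) \<le> fst e \<and> snd (multideg g) \<le> snd e"
proof -
  let ?I = "{h :: 'a poly poly. \<forall>e\<in>supp2 h. \<exists>g\<in>S. fst (multideg g) \<le> fst e \<and> snd (multideg g) \<le> snd e}"
  have "ideal_gen (lead_term2 ` S) \<subseteq> ?I" unfolding ideal_gen_def
  proof (rule ideal_span_minimal)
    show "lead_term2 ` S \<subseteq> ?I"
      by (auto simp: lead_term2_def supp2_def coeff2_term2 split: if_splits)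
        (metis fst_conv snd_conv order_refl)
    show "module.subspace (*) ?I" unfolding ideal_subspace_def
    proof (intro conjI ballI allI)
      show "0 \<in> ?I" using supp2_eq_empty_iff[of "0 :: 'a poly poly"] by simp
      show "g + h \<in> ?I" if "g \<in> ?I" "h \<in> ?I" for g h
      proof -
        have "supp2 (g + h) \<subseteq> supp2 g \<union> supp2 h" by (auto simp: supp2_def coeff2_def)
        then show ?thesis using that by blast
      qed
      show "r * g \<in> ?I" if "g \<in> ?I" for r g
      proof (intro CollectI ballI)
        fix e assume "e \<in> supp2 (r * g)"
        then obtain d where d: "d \<in> supp2 g" "fst d \<le> fst e" "snd d \<le> snd e"
          using supp2_mult by blast
        then obtain u where "u \<in> S" "fst (multideg u) \<le> fst d" "snd (multideg u) \<le> snd d"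
          using \<open>g \<in> ?I\<close> by blast
        with d show "\<exists>g\<in>S. fst (multideg g) \<le> fst e \<and> snd (multideg g) \<le> snd e"
          by (meson le_trans)
      qed
    qed
  qed
  then show ?thesis using assms by blast
qed

lemma groebner_basis_divides_lead:
  fixes J G :: "'a::field poly poly set"
  assumes "groebner_basis J G" "h \<in> J" "h \<noteq> 0"
  shows "\<exists>g\<in>G. fst (multideg g) \<le> fst (multideg h) \<and> snd (multideg g) \<le> snd (multideg h)"
proof (rule supp2_mem_monomial_ideal)
  have "lead_term2 h \<in> ideal_gen (lead_term2 ` J)"
    unfolding ideal_gen_def using assms(2) by (intro ideal_span_base) blast
  then show "lead_term2 h \<in> ideal_gen (lead_term2 ` G)"
    using assms(1) by (simp add: groebner_basis_def)
  show "multideg h \<in> supp2 (lead_term2 h)"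
    using lead_coeff2_nonzero[OF assms(3)] by (simp add: supp2_def lead_term2_def coeff2_term2)
qed

text \<open>Both y^2 and x^3 have weight 6; the tie goes to the smaller power of x, so y^2
  leads.\<close>

lemma curve_eq_cubic_supp2:
  fixes a b c :: "'a::field"
  shows "supp2 (curve_eq (cubic a b c)) \<subseteq> {(2, 0), (0, 0), (0, 1), (0, 2), (0, 3)}"
    and "coeff2 (curve_eq (cubic a b c)) (2, 0) = 1"
    and "coeff2 (curve_eq (cubic a b c)) (0, 3) = -1"
    and "multideg (curve_eq (cubic a b c)) = (2, 0)"
proof -
  show 1: "supp2 (curve_eq (cubic a b c)) \<subseteq> {(2, 0), (0, 0), (0, 1), (0, 2), (0, 3)}"
  proof
    fix e assume "e \<in> supp2 (curve_eq (cubic a b c))"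
    then show "e \<in> {(2, 0), (0, 0), (0, 1), (0, 2), (0, 3)}"
      by (cases e) (auto simp: supp2_def coeff2_def curve_eq_def cubic_def coeff_pCons numeral_2_eq_2
          numeral_3_eq_3 split: nat.splits)
  qed
  show 2: "coeff2 (curve_eq (cubic a b c)) (2, 0) = 1" "coeff2 (curve_eq (cubic a b c)) (0, 3) = -1"
    by (simp_all add: coeff2_def curve_eq_def cubic_def numeral_2_eq_2 numeral_3_eq_3)
  show "multideg (curve_eq (cubic a b c)) = (2, 0)"
  proof (rule multideg_eqI)
    show "(2, 0) \<in> supp2 (curve_eq (cubic a b c))" using 2(1) by (simp add: supp2_def)
    fix e assume "e \<in> supp2 (curve_eq (cubic a b c))" "e \<noteq> (2, 0)"
    with 1 have "e \<in> {(0, 0), (0, 1), (0, 2), (0, 3)}" by blast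
    then show "(2, 0) >\<^sub>2 e" by (auto simp: gt2_def wdeg_def)
  qed
qed

text \<open>The proof cannot rely on \<open>F\<close> being in \<open>G\<close>: for T of order two,
  \<open>J\<close> contains x - x_T because f has a simple root there, and the reduced basis is x -
  x_T together with y^2. What is used is that \<open>F\<close> lies in \<open>J\<close>.\<close>

lemma minimal_element_reduced_groebner_basis:
  fixes F :: "'a::field poly poly"
  assumes F: "F = curve_eq (cubic a b c)" "F \<in> J"
    and diff: "\<And>g h. g \<in> J \<Longrightarrow> h \<in> J \<Longrightarrow> g - h \<in> J"
    and G: "reduced_groebner_basis J G"
    and mem: "h \<in> G - {F}"
    and min: "\<forall>g\<in>G - {F}. g \<noteq> h \<longrightarrow> multideg g >\<^sub>2 multideg h"
    and \<beta>: "[:\<beta>0, \<beta>1:] \<in> J" "[:\<beta>0, \<beta>1:] \<noteq> 0"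
  shows "\<exists>h0 h1. h = [:h0, h1:]" and "wdeg (multideg h) \<le> wdeg (multideg [:\<beta>0, \<beta>1:])"
proof -
  have gb: "groebner_basis J G" and monic: "\<And>g. g \<in> G \<Longrightarrow> lead_coeff2 g = 1"
    and red: "\<And>g e. g \<in> G \<Longrightarrow> e \<in> supp2 g \<Longrightarrow> term2 1 e \<notin> ideal_gen (lead_term2 ` (G - {g}))"
    using G by (auto simp: reduced_groebner_basis_def)
  have hJ: "h \<in> J" using gb mem by (auto simp: groebner_basis_def)
  have Fdeg: "multideg F = (2, 0)" unfolding F(1) by (rule curve_eq_cubic_supp2(4))
  have nz: "g \<noteq> 0" if "g \<in> G" for g
    using monic[OF that] by (auto simp: lead_coeff2_def coeff2_def)
  note lead = groebner_basis_divides_lead[OF gb]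
  obtain g where g: "g \<in> G" "fst (multideg g) \<le> fst (multideg [:\<beta>0, \<beta>1:])"
    "snd (multideg g) \<le> snd (multideg [:\<beta>0, \<beta>1:])"
    using lead[OF \<beta>] by blast
  have "fst (multideg [:\<beta>0, \<beta>1:]) \<le> 1"
    using multideg_mem_supp2[OF \<beta>(2)]
    by (cases "multideg [:\<beta>0, \<beta>1:]") (auto simp: supp2_def coeff2_def coeff_pCons split: nat.splits)
  \<comment> \<open>The leading monomial y^2 of \<open>F\<close> cannot divide one that is at most
    linear in y.\<close>
  with g Fdeg have "g \<noteq> F" by auto
  with min g(1) have "g = h \<or> multideg g >\<^sub>2 multideg h" by blast
  moreover have "wdeg (multideg g) \<le> wdeg (multideg [:\<beta>0, \<beta>1:])"
    using g by (simp add: wdeg_def)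
  ultimately show "wdeg (multideg h) \<le> wdeg (multideg [:\<beta>0, \<beta>1:])"
    using gt2_imp_wdeg_le le_trans by blast
  have fst_le: "fst e \<le> 1" if e: "e \<in> supp2 h" for e
  proof (rule ccontr)
    assume big: "\<not> fst e \<le> 1"
    \<comment> \<open>Since \<open>F\<close> is in \<open>J\<close>, some basis element leads with a
      power y^i, i \<le> 2. It divides the monomial \<open>e\<close> of \<open>h\<close>, so
      reducedness forces it to be \<open>h\<close>.\<close>
    obtain g where g: "g \<in> G" "fst (multideg g) \<le> 2" "snd (multideg g) = 0"
      using lead[OF F(2)] Fdeg by (auto simp: F(1) curve_eq_def)
    have "g = h"
    proof (rule ccontr)
      assume "g \<noteq> h"
      then have "lead_term2 g \<in> ideal_gen (lead_term2 ` (G - {h}))"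
        unfolding ideal_gen_def using g by (intro ideal_span_base) blast
      then have "term2 1 (fst e - fst (multideg g), snd e) * lead_term2 g
          \<in> ideal_gen (lead_term2 ` (G - {h}))"
        unfolding ideal_gen_def by (rule ideal_span_scale)
      also have "term2 1 (fst e - fst (multideg g), snd e) * lead_term2 g = term2 1 e"
        using g big monic[OF g(1)] by (simp add: lead_term2_def term2_mult)
      finally show False using red[of h e] mem e by blast
    qed
    with g have h_deg: "fst (multideg h) \<le> 2" "snd (multideg h) = 0" by auto
    have "wdeg (multideg h) \<ge> 6"
      using multideg_greatest[OF nz e] mem big by (cases "e = multideg h") (auto simp: gt2_def wdeg_def)
    with h_deg have hd: "multideg h = (2, 0)"
      by (cases "multideg h") (auto simp: wdeg_def)
    \<comment> \<open>Subtracting \<open>F\<close> cancels y^2, so \<open>u\<close> leads below y^2,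
      and so does some element of \<open>G\<close>. This contradicts the minimality of
      \<open>h\<close>.\<close>
    define u where "u = h - F"
    have uJ: "u \<in> J" and u0: "u \<noteq> 0" unfolding u_def using diff[OF hJ F(2)] mem by auto
    have "coeff2 u (2, 0) = 0"
      using monic[of h] mem unfolding u_def lead_coeff2_def hd
      using curve_eq_cubic_supp2(2)[of a b c, folded F(1)] by (simp add: coeff2_def)
    then have ne: "multideg u \<noteq> (2, 0)" using multideg_mem_supp2[OF u0] by (auto simp: supp2_def)
    have "multideg u \<in> supp2 h \<union> supp2 F"
      using multideg_mem_supp2[OF u0] unfolding u_def by (auto simp: supp2_def coeff2_def)
    moreover have "F \<noteq> 0" unfolding F(1) curve_eq_def by simp
    ultimately have less: "(2, 0) >\<^sub>2 multideg u"
      using multideg_greatest[of h "multideg u"] multideg_greatest[of F "multideg u"] nz[of h] mem ne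
      unfolding hd Fdeg by auto
    obtain g' where g': "g' \<in> G" "fst (multideg g') \<le> fst (multideg u)"
      "snd (multideg g') \<le> snd (multideg u)"
      using lead[OF uJ u0] by blast
    then have "multideg g' = multideg u \<or> multideg u >\<^sub>2 multideg g'"
      using gt2_of_le by blast
    then have less': "(2, 0) >\<^sub>2 multideg g'" using less gt2_trans by metis
    then have "g' \<noteq> h" "g' \<noteq> F" using hd Fdeg gt2_irrefl by auto
    then have "multideg g' >\<^sub>2 (2, 0)" using min g'(1) hd by auto
    then show False using less' gt2_asym by blast
  qed
  have "coeff h m = 0" if "m \<ge> 2" for m
  proof (rule poly_eqI)
    fix j
    show "coeff (coeff h m) j = coeff 0 j"
      using fst_le[of "(m, j)"] that by (auto simp: supp2_def coeff2_def)
  qed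
  then have "h = [:coeff h 0, coeff h 1:]"
    by (intro poly_eqI) (simp add: coeff_pCons numeral_2_eq_2 split: nat.split)
  then show "\<exists>h0 h1. h = [:h0, h1:]" by blast
qed

lemma supp2_linear: "e \<in> supp2 [:h0, h1:] \<longleftrightarrow>
    fst e = 0 \<and> coeff h0 (snd e) \<noteq> 0 \<or> fst e = 1 \<and> coeff h1 (snd e) \<noteq> 0"
  by (cases e) (auto simp: supp2_def coeff2_def coeff_pCons split: nat.splits)

text \<open>On $K[x] + K[x] y$ the weight is the pole order at infinity, i.e. the degree of the norm.\<close>

lemma curve_norm_degree:
  fixes f :: "'a::field poly"
  assumes f: "degree f = 3" "lead_coeff f = 1" and nz: "[:h0, h1:] \<noteq> 0"
  shows "curve_norm f h0 h1 \<noteq> 0" and "degree (curve_norm f h0 h1) = wdeg (multideg [:h0, h1:])"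
    and "lead_coeff (curve_norm f h0 h1) = (lead_coeff2 [:h0, h1:])\<^sup>2 \<or>
      lead_coeff (curve_norm f h0 h1) = - (lead_coeff2 [:h0, h1:])\<^sup>2"
proof -
  have f0: "f \<noteq> 0" using f by auto
  have d0: "degree (h0\<^sup>2) = 2 * degree h0" by (cases "h0 = 0") (simp_all add: degree_power_eq)
  have d1: "degree (h1\<^sup>2 * f) = 2 * degree h1 + 3" if "h1 \<noteq> 0"
    using that f f0 by (simp add: degree_mult_eq power2_eq_square)
  have l1: "lead_coeff (h1\<^sup>2 * f) = (lead_coeff h1)\<^sup>2"
    unfolding lead_coeff_mult lead_coeff_power f(2) by simp
  have main: "curve_norm f h0 h1 \<noteq> 0 \<and> degree (curve_norm f h0 h1) = wdeg (multideg [:h0, h1:]) \<and>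
    (lead_coeff (curve_norm f h0 h1) = (lead_coeff2 [:h0, h1:])\<^sup>2 \<or>
      lead_coeff (curve_norm f h0 h1) = - (lead_coeff2 [:h0, h1:])\<^sup>2)"
  \<comment> \<open>Decides whether \<open>h0\<close> or \<open>h1 y\<close> leads, by comparing the
    weights 2 deg h0 and 2 deg h1 + 3. The zero polynomial has degree 0 and has to be treated
    separately.\<close>
  proof (cases "h1 = 0 \<or> (h0 \<noteq> 0 \<and> 2 * degree h1 + 3 < 2 * degree h0)")
    case True
    then have h0: "h0 \<noteq> 0" using nz by auto
    have md: "multideg [:h0, h1:] = (0, degree h0)"
    proof (rule multideg_eqI)
      show "(0, degree h0) \<in> supp2 [:h0, h1:]" using h0 by (simp add: supp2_linear)
      fix e assume "e \<in> supp2 [:h0, h1:]" "e \<noteq> (0, degree h0)"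
      then show "(0, degree h0) >\<^sub>2 e" using True le_degree[of h0 "snd e"] le_degree[of h1 "snd e"]
        by (cases e) (auto simp: supp2_linear gt2_def wdeg_def)
    qed
    have lc: "lead_coeff2 [:h0, h1:] = lead_coeff h0" unfolding lead_coeff2_def md by (simp add: coeff2_def)
    have small: "h1 = 0 \<or> degree (h1\<^sup>2 * f) < degree (h0\<^sup>2)" using True d0 d1 by (cases "h1 = 0") simp_all
    then have dd: "degree (curve_norm f h0 h1) = 2 * degree h0"
    proof
      assume "degree (h1\<^sup>2 * f) < degree (h0\<^sup>2)"
      then show ?thesis unfolding curve_norm_def diff_conv_add_uminus
        by (subst degree_add_eq_left) (simp_all add: d0)
    qed (simp add: curve_norm_def d0)
    have "coeff (h1\<^sup>2 * f) (2 * degree h0) = 0"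
      using small d0 by (auto intro: coeff_eq_0)
    then have "coeff (curve_norm f h0 h1) (2 * degree h0) = (lead_coeff h0)\<^sup>2"
      using lead_coeff_power[of h0 2] unfolding curve_norm_def d0 by simp
    then have ll: "lead_coeff (curve_norm f h0 h1) = (lead_coeff h0)\<^sup>2" unfolding dd .
    moreover have "curve_norm f h0 h1 \<noteq> 0" using ll h0 by auto
    ultimately show ?thesis using dd unfolding lc md by (simp add: wdeg_def)
  next
    case False
    then have h1: "h1 \<noteq> 0" by auto
    \<comment> \<open>Parity excludes a tie of weights, and with it a cancellation of h0^2 against
      h1^2 f.\<close>
    have neq: "2 * degree h0 \<noteq> 2 * degree h1 + 3" by presburger
    have md: "multideg [:h0, h1:] = (1, degree h1)"
    proof (rule multideg_eqI)
      show "(1, degree h1) \<in> supp2 [:h0, h1:]" using h1 by (simp add: supp2_linear)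
      fix e assume "e \<in> supp2 [:h0, h1:]" "e \<noteq> (1, degree h1)"
      then show "(1, degree h1) >\<^sub>2 e" using False neq le_degree[of h0 "snd e"] le_degree[of h1 "snd e"]
        by (cases e) (auto simp: supp2_linear gt2_def wdeg_def)
    qed
    have lc: "lead_coeff2 [:h0, h1:] = lead_coeff h1" unfolding lead_coeff2_def md by (simp add: coeff2_def)
    have small: "h0 = 0 \<or> degree (h0\<^sup>2) < degree (h1\<^sup>2 * f)" using False neq d0 d1[OF h1] by auto
    have dd: "degree (curve_norm f h0 h1) = 2 * degree h1 + 3"
      using small
    proof
      assume "degree (h0\<^sup>2) < degree (h1\<^sup>2 * f)"
      then show ?thesis unfolding curve_norm_def diff_conv_add_uminus
        by (subst degree_add_eq_right) (simp_all add: d1[OF h1])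
    qed (simp add: curve_norm_def d1[OF h1])
    have "coeff (h0\<^sup>2) (2 * degree h1 + 3) = 0"
      using small d1[OF h1] by (auto intro: coeff_eq_0)
    then have "coeff (curve_norm f h0 h1) (2 * degree h1 + 3) = - (lead_coeff h1)\<^sup>2"
      using l1 unfolding curve_norm_def d1[OF h1] by simp
    then have ll: "lead_coeff (curve_norm f h0 h1) = - (lead_coeff h1)\<^sup>2" unfolding dd .
    moreover have "curve_norm f h0 h1 \<noteq> 0" using ll h1 by auto
    ultimately show ?thesis using dd unfolding lc md by (simp add: wdeg_def)
  qed
  from main show "curve_norm f h0 h1 \<noteq> 0" "degree (curve_norm f h0 h1) = wdeg (multideg [:h0, h1:])"
    "lead_coeff (curve_norm f h0 h1) = (lead_coeff2 [:h0, h1:])\<^sup>2 \<or>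
      lead_coeff (curve_norm f h0 h1) = - (lead_coeff2 [:h0, h1:])\<^sup>2" by blast+
qed

section \<open>Orders of vanishing at affine points\<close>

text \<open>\<open>GREATEST\<close> requires a bound. The powers of the ideal decrease, so failure
  at \<open>k + 1\<close> excludes all larger exponents.\<close>

lemma ord_at_eqI:
  assumes "eval2 s p q \<noteq> 0" "s * h \<in> points_ideal F (replicate k (p, q))"
    and "\<And>s. eval2 s p q \<noteq> 0 \<Longrightarrow> s * h \<notin> points_ideal F (replicate (Suc k) (p, q))"
  shows "ord_at F p q h = k"
  unfolding ord_at_def point_power_ideal_eq_points_ideal
proof (rule Greatest_equality)
  show "\<exists>s. eval2 s p q \<noteq> 0 \<and> s * h \<in> points_ideal F (replicate k (p, q))"
    using assms(1,2) by blast
next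
  fix j assume "\<exists>s. eval2 s p q \<noteq> 0 \<and> s * h \<in> points_ideal F (replicate j (p, q))"
  then obtain s where s: "eval2 s p q \<noteq> 0" "s * h \<in> points_ideal F (replicate j (p, q))" by blast
  show "j \<le> k"
  proof (rule ccontr)
    assume "\<not> j \<le> k"
    then have "Suc k \<le> j" by simp
    then show False
      using subsetD[OF points_ideal_replicate_antimono s(2)] assms(3)[OF s(1)] by blast
  qed
qed

lemma ord_at_eq_0:
  assumes "eval2 F p q = 0" "eval2 h p q \<noteq> 0"
  shows "ord_at F p q h = 0"
proof (rule ord_at_eqI[where s = 1])
  fix s assume "eval2 s p q \<noteq> 0"
  then show "s * h \<notin> points_ideal F (replicate (Suc 0) (p, q))"
    using assms by (simp add: mem_points_ideal_iff_eval2)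
qed auto

lemma eval2_curve_eq: "eval2 (curve_eq f) p q = 0 \<longleftrightarrow> q\<^sup>2 = poly f p"
  by (simp add: curve_eq_def eval2_def power2_eq_square)

lemma curve_norm_eq_eval2:
  "poly (curve_norm f h0 h1) p = eval2 [:h0, h1:] p q * eval2 [:h0, h1:] p (- q)"
  if "q\<^sup>2 = poly f p"
  using that[symmetric] by (simp add: curve_norm_def eval2_linear power2_eq_square algebra_simps)

text \<open>If s b were in the (n+1)-st power, the norm r N(s) (x - p)^n of s b would be divisible
  by (x - p)^(n+1), so N(s) would vanish at p. But N(s)(p) = s(T) s(-T).\<close>

lemma ord_at_norm_power:
  fixes f :: "'a::field poly"
  assumes two: "(2::'a) \<noteq> 0" and on: "q\<^sup>2 = poly f p"
    and mem: "[:b0, b1:] \<in> points_ideal (curve_eq f) (replicate n (p, q))"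
    and N: "curve_norm f b0 b1 = smult r ([:-p, 1:] ^ n)" "r \<noteq> 0"
  shows "ord_at (curve_eq f) p q [:b0, b1:] = n"
proof (rule ord_at_eqI[where s = 1])
  let ?F = "curve_eq f" and ?b = "[:b0, b1:]" and ?I = "points_ideal (curve_eq f) (replicate (Suc n) (p, q))"
  fix s assume s: "eval2 s p q \<noteq> 0"
  show "s * ?b \<notin> ?I"
  proof
    assume sb: "s * ?b \<in> ?I"
    \<comment> \<open>Adding \<open>y - q\<close> to \<open>s\<close> makes it nonzero at \<open>-T\<close> too, so that its norm is nonzero at \<open>p\<close>.\<close>
    obtain s' where s': "eval2 s' p q \<noteq> 0" "eval2 s' p (- q) \<noteq> 0" "s' * ?b \<in> ?I"
    proof (cases "eval2 s p (- q) = 0")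
      case True
      then have "q \<noteq> 0" using s by auto
      have "y_minus q * ?b \<in> ?I"
        using points_ideal_y[OF mem, of "(p, q)"] by simp
      then have "(s + y_minus q) * ?b \<in> ?I"
        unfolding distrib_right by (rule points_ideal_add[OF sb])
      moreover have "eval2 (s + y_minus q) p (- q) \<noteq> 0"
        using True \<open>q \<noteq> 0\<close> two by (simp add: mult_2[symmetric] minus_diff_eq flip: minus_add_distrib)
      moreover have "eval2 (s + y_minus q) p q \<noteq> 0" using s by simp
      ultimately show ?thesis using that by blast
    next
      case False
      then show ?thesis using that s sb by blast
    qed
    obtain s0 s1 where s01: "?F dvd s' - [:s0, s1:]" using curve_eq_reduce by blast
    have ev: "eval2 [:s0, s1:] p q \<noteq> 0" "eval2 [:s0, s1:] p (- q) \<noteq> 0"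
      using eval2_eq_0_of_dvd[OF s01, of p q] eval2_eq_0_of_dvd[OF s01, of p "- q"] s' on
      by (simp_all add: eval2_curve_eq)
    define k0 k1 where "k0 = s0 * b0 + s1 * b1 * f" and "k1 = s0 * b1 + s1 * b0"
    have "?F dvd (s' - [:s0, s1:]) * ?b + ?F * [:s1 * b1:]"
      by (intro dvd_add dvd_mult2 s01) simp
    also have "(s' - [:s0, s1:]) * ?b + ?F * [:s1 * b1:] = s' * ?b - [:k0, k1:]"
      unfolding left_diff_distrib k0_def k1_def by (simp add: curve_eq_def algebra_simps)
    finally have "[:k0, k1:] \<in> ?I" using s'(3) points_ideal_cong by blast
    from curve_norm_dvd[OF on this] have "[:-p, 1:] ^ Suc n dvd curve_norm f k0 k1" .
    also have "curve_norm f k0 k1 = curve_norm f s0 s1 * curve_norm f b0 b1"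
      unfolding k0_def k1_def curve_norm_def by (rule norm_form_mult)
    also have "\<dots> = smult r (curve_norm f s0 s1) * [:-p, 1:] ^ n" unfolding N(1) by simp
    finally have "[:-p, 1:] * [:-p, 1:] ^ n dvd smult r (curve_norm f s0 s1) * [:-p, 1:] ^ n"
      by (simp only: power_Suc)
    then have "[:-p, 1:] dvd smult r (curve_norm f s0 s1)"
      by (subst (asm) dvd_mult_cancel_right) simp
    then have "poly (smult r (curve_norm f s0 s1)) p = 0" by (simp only: poly_eq_0_iff_dvd)
    then show False using N(2) ev by (simp add: curve_norm_eq_eval2[OF on])
  qed
qed (use mem in auto)

text \<open>The norm alone does not separate T from -T. If b vanished at -T, its conjugate would
  vanish at T, and the norm r (x - p)^n would lie in the (n+1)-st power of the ideal at T.
  Multiplied by (y + q)^(n+1), it would be divisible by (x - p)^(n+1) on E; cancelling (x - p)^n and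
  evaluating at T gives r (2q)^(n+1) = 0.\<close>

lemma eval2_neg_nonzero:
  fixes f :: "'a::field poly"
  assumes two: "(2::'a) \<noteq> 0" and on: "q\<^sup>2 = poly f p" and q: "q \<noteq> 0"
    and mem: "[:b0, b1:] \<in> points_ideal (curve_eq f) (replicate n (p, q))"
    and N: "curve_norm f b0 b1 = smult r ([:-p, 1:] ^ n)" "r \<noteq> 0"
  shows "eval2 [:b0, b1:] p (- q) \<noteq> 0"
proof
  let ?F = "curve_eq f" and ?b = "[:b0, b1:]" and ?X = "[:-p, 1:]"
  assume "eval2 ?b p (- q) = 0"
  then have "conj_y ?b \<in> points_ideal ?F [(p, q)]"
    using on by (simp add: mem_points_ideal_iff_eval2 eval2_curve_eq eval2_conj_y)
  with mem have "?b * conj_y ?b \<in> points_ideal ?F (replicate n (p, q) @ [(p, q)])"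
    by (rule points_ideal_append)
  then have "[:curve_norm f b0 b1:] \<in> points_ideal ?F (replicate (Suc n) (p, q))"
    using points_ideal_cong[OF mult_conj_y_curve_norm]
    unfolding replicate_append_same replicate_Suc[symmetric] by blast
  moreover have "y_minus (- q) ^ Suc n \<in> points_ideal ?F (map neg_point (replicate (Suc n) (p, q)))"
    using points_ideal_power[of "y_minus (- q)" ?F "(p, - q)" "Suc n"] on
    by (simp add: mem_points_ideal_iff_eval2 eval2_curve_eq del: replicate_Suc power_Suc)
  ultimately obtain k where k: "?F dvd [:curve_norm f b0 b1:] * y_minus (- q) ^ Suc n
      - (\<Prod>P\<leftarrow>replicate (Suc n) (p, q). x_minus (fst P)) * k"
    using points_ideal_mult_neg[of "replicate (Suc n) (p, q)" f] on by force
  have "(\<Prod>P\<leftarrow>replicate (Suc n) (p, q). x_minus (fst P)) = [:?X ^ n:] * x_minus p"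
    by (simp only: map_replicate prod_list_replicate fst_conv power_Suc x_minus_power mult.commute)
  moreover have "[:curve_norm f b0 b1:] = [:?X ^ n:] * [:[:r:]:]" unfolding N(1) by simp
  ultimately have "?F dvd [:?X ^ n:] * ([:[:r:]:] * y_minus (- q) ^ Suc n - x_minus p * k)"
    using k by (simp only: right_diff_distrib mult.assoc)
  then have "?F dvd [:[:r:]:] * y_minus (- q) ^ Suc n - x_minus p * k"
    by (subst (asm) curve_eq_dvd_const_mult_iff) simp_all
  then have "eval2 ([:[:r:]:] * y_minus (- q) ^ Suc n - x_minus p * k) p q = 0"
    by (rule eval2_eq_0_of_dvd) (simp add: eval2_curve_eq on)
  then have "r * (q + q) ^ Suc n = 0"
    unfolding eval2_diff eval2_mult eval2_power by (simp add: eval2_const del: power_Suc)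
  then show False using N(2) q two by (simp add: mult_2[symmetric] del: power_Suc)
qed

text \<open>A zero lies over a root of the norm, hence over p, where E has only the points T and
  -T.\<close>

lemma eval2_other_nonzero:
  fixes f :: "'a::field poly"
  assumes two: "(2::'a) \<noteq> 0" and on: "q\<^sup>2 = poly f p"
    and mem: "[:b0, b1:] \<in> points_ideal (curve_eq f) (replicate n (p, q))"
    and N: "curve_norm f b0 b1 = smult r ([:-p, 1:] ^ n)" "r \<noteq> 0"
    and xy: "y\<^sup>2 = poly f x" "(x, y) \<noteq> (p, q)"
  shows "eval2 [:b0, b1:] x y \<noteq> 0"
proof
  assume 0: "eval2 [:b0, b1:] x y = 0"
  then have "poly (curve_norm f b0 b1) x = 0" by (simp add: curve_norm_eq_eval2[OF xy(1)])
  then have "x = p" using N by simp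
  moreover from this have "y = - q" using xy on by (metis power2_eq_iff)
  moreover have "q \<noteq> 0" using xy calculation by auto
  ultimately show False using eval2_neg_nonzero[OF two on _ mem N] 0 by blast
qed

section \<open>Orders of vanishing at infinity\<close>

text \<open>
  Near $O = [0:1:0]$ the curve is $u z = x^3$ with the unit $u = 1 - a x^2 - b x z - c z^2$, so
  that $x$ is a uniformizer there.
\<close>

definition inf_unit :: "'a::comm_ring_1 \<Rightarrow> 'a \<Rightarrow> 'a \<Rightarrow> 'a poly poly" where
  "inf_unit a b c = [:[:1, 0, - a:], [:0, - b:], [:- c:]:]"

text \<open>The curve u z - x^3 in the chart y = 1. The outer variable is now z, so
  \<open>x_minus 0\<close> is x and \<open>y_minus 0\<close> is z.\<close>

definition inf_eq :: "'a::comm_ring_1 \<Rightarrow> 'a \<Rightarrow> 'a \<Rightarrow> 'a poly poly" where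
  "inf_eq a b c = pCons (- ([:0, 1:] ^ 3)) (inf_unit a b c)"

lemma inf_unit_mult: "inf_unit a b c * y_minus 0 - x_minus 0 ^ 3 = inf_eq a b c"
  unfolding x_minus_power by (simp add: inf_eq_def y_minus_def)

lemma eval2_inf_eq: "eval2 (inf_eq a b c) 0 0 = 0"
  by (simp add: inf_eq_def eval2_def)

lemma eval2_inf_unit: "eval2 (inf_unit a b c) 0 0 = 1"
  by (simp add: inf_unit_def eval2_def)

text \<open>The element x is prime and does not divide the equation of the curve, whose coefficient
  of z is 1 - a x^2; so x can be cancelled on the curve.\<close>

lemma inf_eq_dvd_x_mult:
  fixes a b c :: "'a::field"
  assumes "inf_eq a b c dvd x_minus 0 * h"
  shows "inf_eq a b c dvd h"
proof -
  obtain q where q: "x_minus 0 * h = inf_eq a b c * q" using assms by (rule dvdE)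
  have prime: "prime_elem (x_minus (0::'a))"
    unfolding x_minus_def prime_elem_const_poly_iff by (rule prime_elem_linear_field_poly) simp
  have "\<not> x_minus 0 dvd inf_eq a b c"
  proof
    assume "x_minus 0 dvd inf_eq a b c"
    then have "[:- 0, 1:] dvd coeff (inf_eq a b c) 1" unfolding x_minus_def const_poly_dvd_iff by blast
    then show False unfolding poly_eq_0_iff_dvd[symmetric] by (simp add: inf_eq_def inf_unit_def)
  qed
  moreover have "x_minus 0 dvd inf_eq a b c * q" unfolding q[symmetric] by simp
  ultimately have "x_minus 0 dvd q" using prime_elem_dvd_multD[OF prime] by blast
  then obtain q' where "q = x_minus 0 * q'" by (rule dvdE)
  then have "x_minus 0 * h = x_minus 0 * (inf_eq a b c * q')" using q by (simp add: ac_simps)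
  moreover have "x_minus (0::'a) \<noteq> 0" by (simp add: x_minus_def)
  ultimately show ?thesis by simp
qed

lemma inf_eq_dvd_x_power_mult:
  fixes a b c :: "'a::field"
  shows "inf_eq a b c dvd x_minus 0 ^ k * h \<Longrightarrow> inf_eq a b c dvd h"
proof (induction k)
  case (Suc k)
  from Suc.prems have "inf_eq a b c dvd x_minus 0 * (x_minus 0 ^ k * h)"
    by (simp only: power_Suc mult.assoc)
  then show ?case by (rule Suc.IH[OF inf_eq_dvd_x_mult])
qed simp

text \<open>Expresses without localization that x is a uniformizer: multiplied by u, both generators
  x and z of the maximal ideal become multiples of x, since u z = x^3.\<close>

lemma inf_unit_power_mult:
  fixes a b c :: "'a::field"
  assumes "g \<in> points_ideal (inf_eq a b c) (replicate k (0, 0))"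
  shows "\<exists>g'. inf_eq a b c dvd inf_unit a b c ^ k * g - x_minus 0 ^ k * g'"
  using assms
proof (induction k arbitrary: g)
  case 0
  show ?case by (intro exI[of _ g]) simp
next
  case (Suc k)
  let ?F = "inf_eq a b c" and ?u = "inf_unit a b c" and ?x = "x_minus (0::'a)" and ?z = "y_minus (0::'a)"
  obtain g1 g2 l where g: "g1 \<in> points_ideal ?F (replicate k (0, 0))"
    "g2 \<in> points_ideal ?F (replicate k (0, 0))" "g = ?x * g1 + ?z * g2 + ?F * l"
    using Suc.prems unfolding replicate_Suc
    by (rule points_ideal_ConsE[where P = "(0, 0)", unfolded fst_conv snd_conv])
  obtain g1' g2' where *: "?F dvd ?u ^ k * g1 - ?x ^ k * g1'" "?F dvd ?u ^ k * g2 - ?x ^ k * g2'"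
    using Suc.IH g by blast
  have "?F dvd ?u * ?x * (?u ^ k * g1 - ?x ^ k * g1') + ?u * ?z * (?u ^ k * g2 - ?x ^ k * g2')
      + ?F * (?u ^ Suc k * l) + (?u * ?z - ?x ^ 3) * (?x ^ k * g2')"
    unfolding inf_unit_mult by (intro dvd_add dvd_mult * dvd_triv_left)
  also have "\<dots> = ?u ^ Suc k * g - ?x ^ Suc k * (?u * g1' + ?x\<^sup>2 * g2')"
    unfolding g(3) by (simp add: power2_eq_square power3_eq_cube algebra_simps)
  finally show ?case by blast
qed

text \<open>If s h were in the (k+1)-st power, then x^k (x u^N g - u^(k+1) s w) would vanish on the
  curve for some g. Cancelling x^k and evaluating at the origin gives s(O) w(O) = 0.\<close>

lemma ord_at_inf_eqI:
  fixes a b c :: "'a::field"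
  assumes dvd: "inf_eq a b c dvd inf_unit a b c ^ N * h - x_minus 0 ^ k * w" and w: "eval2 w 0 0 \<noteq> 0"
  shows "ord_at (inf_eq a b c) 0 0 h = k"
proof (rule ord_at_eqI[where s = "inf_unit a b c ^ N"])
  let ?F = "inf_eq a b c" and ?u = "inf_unit a b c" and ?x = "x_minus (0::'a)"
  show "eval2 (?u ^ N) 0 0 \<noteq> 0" by (simp add: eval2_inf_unit)
  have "?x \<in> points_ideal ?F [(0, 0)]" by (simp add: mem_points_ideal_iff_eval2 eval2_inf_eq)
  then have "?x ^ k * w \<in> points_ideal ?F (replicate k (0, 0))"
    by (intro points_ideal_mult_right points_ideal_power)
  then show "?u ^ N * h \<in> points_ideal ?F (replicate k (0, 0))"
    using points_ideal_cong[OF dvd] by blast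
  fix s :: "'a poly poly" assume s: "eval2 s 0 0 \<noteq> 0"
  show "s * h \<notin> points_ideal ?F (replicate (Suc k) (0, 0))"
  proof
    assume "s * h \<in> points_ideal ?F (replicate (Suc k) (0, 0))"
    then obtain g where g: "?F dvd ?u ^ Suc k * (s * h) - ?x ^ Suc k * g"
      using inf_unit_power_mult by blast
    have "?F dvd ?u ^ Suc k * s * (?u ^ N * h - ?x ^ k * w) - ?u ^ N * (?u ^ Suc k * (s * h) - ?x ^ Suc k * g)"
      by (intro dvd_diff dvd_mult dvd g)
    also have "\<dots> = ?x ^ k * (?u ^ N * ?x * g - ?u ^ Suc k * s * w)"
      by (simp add: algebra_simps)
    finally have "?F dvd ?u ^ N * ?x * g - ?u ^ Suc k * s * w" by (rule inf_eq_dvd_x_power_mult)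
    then have "eval2 (?u ^ N * ?x * g - ?u ^ Suc k * s * w) 0 0 = 0"
      by (rule eval2_eq_0_of_dvd) (rule eval2_inf_eq)
    then show False using s w by (simp add: eval2_inf_unit)
  qed
qed

lemma inf_unit_y_power:
  "inf_eq a b c dvd inf_unit a b c ^ j * y_minus 0 ^ j - x_minus 0 ^ (3 * j)"
proof (induction j)
  case (Suc j)
  let ?F = "inf_eq a b c" and ?u = "inf_unit a b c" and ?x = "x_minus 0" and ?z = "y_minus 0"
  have "?F dvd (?u * ?z - ?x ^ 3) * (?u ^ j * ?z ^ j) + ?x ^ 3 * (?u ^ j * ?z ^ j - ?x ^ (3 * j))"
    unfolding inf_unit_mult using Suc by (intro dvd_add dvd_mult dvd_triv_left)
  also have "\<dots> = ?u ^ Suc j * ?z ^ Suc j - ?x ^ (3 * Suc j)"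
    by (simp add: algebra_simps power_add)
  finally show ?case .
qed simp

section \<open>Homogenizations\<close>

lemma sum_term2: "h = (\<Sum>e\<in>supp2 h. term2 (coeff2 h e) e)"
proof (intro poly_eqI)
  fix m j
  have "coeff (coeff (\<Sum>e\<in>supp2 h. term2 (coeff2 h e) e) m) j
      = (\<Sum>e\<in>supp2 h. coeff2 (term2 (coeff2 h e) e) (m, j))"
    by (simp add: coeff_sum coeff2_def)
  also have "\<dots> = (if (m, j) \<in> supp2 h then coeff2 h (m, j) else 0)"
    by (simp add: coeff2_term2 finite_supp2 if_distrib cong: if_cong)
  also have "\<dots> = coeff (coeff h m) j" by (simp add: supp2_def coeff2_def)
  finally show "coeff (coeff h m) j = coeff (coeff (\<Sum>e\<in>supp2 h. term2 (coeff2 h e) e) m) j" ..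
qed

lemma poly_homogenize_1: "poly (homogenize h) 1 = h"
  unfolding homogenize_def poly_sum poly_monom by (simp flip: sum_term2)

lemma total_degree2_ge: "e \<in> supp2 h \<Longrightarrow> fst e + snd e \<le> total_degree2 h"
  unfolding total_degree2_def by (intro Max_ge) (auto simp: finite_supp2)

lemma local_eq_homogenize_Inf:
  "local_eq (homogenize h) Inf
    = (\<Sum>e\<in>supp2 h. monom (monom (coeff2 h e) (snd e)) (total_degree2 h - (fst e + snd e)))"
proof (rule poly_eqI)
  fix k
  have "poly (term2 (coeff2 h e) e) 1 = monom (coeff2 h e) (snd e)" for e
    by (simp add: term2_def poly_monom)
  then show "coeff (local_eq (homogenize h) Inf) k
      = coeff (\<Sum>e\<in>supp2 h. monom (monom (coeff2 h e) (snd e)) (total_degree2 h - (fst e + snd e))) k"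
    by (auto simp: coeff_map_poly homogenize_def coeff_sum poly_sum intro!: sum.cong)
qed

lemma total_degree2_curve_eq_cubic:
  fixes a b c :: "'a::field"
  shows "total_degree2 (curve_eq (cubic a b c)) = 3"
  unfolding total_degree2_def
proof (rule Max_eqI)
  have "(0, 3) \<in> supp2 (curve_eq (cubic a b c))"
    by (simp add: supp2_def curve_eq_cubic_supp2(3))
  then show "3 \<in> insert 0 ((\<lambda>e. fst e + snd e) ` supp2 (curve_eq (cubic a b c)))" by force
next
  fix y assume "y \<in> insert 0 ((\<lambda>e. fst e + snd e) ` supp2 (curve_eq (cubic a b c)))"
  then show "y \<le> 3" using curve_eq_cubic_supp2(1)[of a b c] by auto
qed (simp add: finite_supp2)

lemma local_eq_curve_eq_Inf:
  fixes a b c :: "'a::field"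
  shows "local_eq (homogenize (curve_eq (cubic a b c))) Inf = inf_eq a b c"
proof -
  let ?h = "curve_eq (cubic a b c)" and ?S = "{(2, 0), (0, 0), (0, 1), (0, 2), (0, 3 :: nat)} :: (nat \<times> nat) set"
  have "local_eq (homogenize ?h) Inf
      = (\<Sum>e\<in>?S. monom (monom (coeff2 ?h e) (snd e)) (3 - (fst e + snd e)))"
    unfolding local_eq_homogenize_Inf total_degree2_curve_eq_cubic
    by (rule sum.mono_neutral_left) (use curve_eq_cubic_supp2(1)[of a b c] in \<open>auto simp: supp2_def\<close>)
  also have "\<dots> = inf_eq a b c"
    by (simp add: coeff2_def curve_eq_def cubic_def inf_eq_def inf_unit_def numeral_2_eq_2 numeral_3_eq_3
        monom_Suc monom_0)
  finally show ?thesis .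
qed

text \<open>With D the total degree, the monomial y^m x^i becomes x^i z^(D-m-i) near O. As z has
  order 3 there, its order is i + 3 (D - m - i) = 3 D - (3 m + 2 i): this is where the weight comes
  from.\<close>

lemma ord_at_homogenize_Inf:
  fixes a b c :: "'a::field"
  assumes nz: "[:h0, h1:] \<noteq> 0"
  shows "wdeg (multideg [:h0, h1:]) \<le> 3 * total_degree2 [:h0, h1:]"
    and "ord_at (inf_eq a b c) 0 0 (local_eq (homogenize [:h0, h1:]) Inf)
      = 3 * total_degree2 [:h0, h1:] - wdeg (multideg [:h0, h1:])"
proof -
  let ?h = "[:h0, h1:]"
  let ?F = "inf_eq a b c" and ?u = "inf_unit a b c" and ?x = "x_minus (0::'a)" and ?z = "y_minus (0::'a)"
  define D W where "D = total_degree2 ?h" and "W = wdeg (multideg ?h)"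
  define j where "j = (\<lambda>e::nat \<times> nat. D - (fst e + snd e))"
  have le: "fst e + snd e \<le> D" if "e \<in> supp2 ?h" for e
    unfolding D_def using that by (rule total_degree2_ge)
  \<comment> \<open>As m \<le> 1, the parity of 3 m + 2 i determines m, so no two monomials share a
    weight and the largest weight is attained only once.\<close>
  have lead: "wdeg e < W \<or> e = multideg ?h" if e: "e \<in> supp2 ?h" for e
  proof (rule ccontr)
    assume *: "\<not> (wdeg e < W \<or> e = multideg ?h)"
    then have "wdeg e = W" using multideg_greatest[OF nz e] gt2_imp_wdeg_le unfolding W_def by fastforce
    then have "e = multideg ?h"
      using e multideg_mem_supp2[OF nz] unfolding W_def wdeg_def
      by (cases e; cases "multideg ?h") (auto simp: supp2_linear; presburger)
    then show False using * by blast
  qed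
  show WD: "W \<le> 3 * D"
    using le[OF multideg_mem_supp2[OF nz]] unfolding W_def wdeg_def by simp
  \<comment> \<open>What is left of u^D times the local equation once each u z is replaced by x^3
    and x^(3D-W) is taken out. At the origin only the leading monomial survives.\<close>
  define w where "w = (\<Sum>e\<in>supp2 ?h. [:[:coeff2 ?h e:]:] * ?x ^ (W - wdeg e) * ?u ^ (D - j e))"
  have monom2: "monom (monom d i) k = [:[:d:]:] * ?x ^ i * ?z ^ k" for d :: 'a and i k
  proof -
    have z: "?z ^ k = monom 1 k" for k by (simp add: y_minus_def monom_altdef)
    have "[:0, 1:] ^ i = monom (1::'a) i" by (simp add: monom_altdef)
    then show ?thesis unfolding z x_minus_power by (simp add: smult_monom)
  qed
  have summand: "?F dvd ?u ^ D * monom (monom (coeff2 ?h e) (snd e)) (j e)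
      - ?x ^ (3 * D - W) * ([:[:coeff2 ?h e:]:] * ?x ^ (W - wdeg e) * ?u ^ (D - j e))"
    if e: "e \<in> supp2 ?h" for e
  proof -
    have "snd e + 3 * j e = (3 * D - W) + (W - wdeg e)"
    proof -
      have "wdeg e \<le> W" using lead[OF e] by (auto simp: W_def)
      then show ?thesis using le[OF e] WD by (simp add: j_def wdeg_def)
    qed
    then have x: "?x ^ snd e * ?x ^ (3 * j e) = ?x ^ (3 * D - W) * ?x ^ (W - wdeg e)"
      by (simp only: power_add[symmetric])
    have "D = (D - j e) + j e" unfolding j_def using le[OF e] by simp
    then have u: "?u ^ D = ?u ^ (D - j e) * ?u ^ j e" by (metis power_add)
    have "?F dvd [:[:coeff2 ?h e:]:] * ?x ^ snd e * ?u ^ (D - j e) * (?u ^ j e * ?z ^ j e - ?x ^ (3 * j e))"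
      by (rule dvd_mult[OF inf_unit_y_power])
    also have "\<dots> = ?u ^ D * ([:[:coeff2 ?h e:]:] * ?x ^ snd e * ?z ^ j e)
        - [:[:coeff2 ?h e:]:] * (?x ^ snd e * ?x ^ (3 * j e)) * ?u ^ (D - j e)"
      unfolding u right_diff_distrib by (simp only: ac_simps)
    finally show ?thesis unfolding monom2 x by (simp only: ac_simps)
  qed
  have "?F dvd (\<Sum>e\<in>supp2 ?h. ?u ^ D * monom (monom (coeff2 ?h e) (snd e)) (j e)
      - ?x ^ (3 * D - W) * ([:[:coeff2 ?h e:]:] * ?x ^ (W - wdeg e) * ?u ^ (D - j e)))"
    by (rule dvd_sum) (rule summand)
  also have "\<dots> = ?u ^ D * local_eq (homogenize ?h) Inf - ?x ^ (3 * D - W) * w"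
    unfolding sum_subtractf local_eq_homogenize_Inf w_def sum_distrib_left j_def D_def ..
  finally have dvd: "?F dvd ?u ^ D * local_eq (homogenize ?h) Inf - ?x ^ (3 * D - W) * w" .
  have sum_eval: "eval2 (sum t A) 0 0 = (\<Sum>e\<in>A. eval2 (t e) 0 0)" for t :: "nat \<times> nat \<Rightarrow> 'a poly poly" and A
    by (induction A rule: infinite_finite_induct) simp_all
  have "eval2 w 0 0 = (\<Sum>e\<in>supp2 ?h. coeff2 ?h e * 0 ^ (W - wdeg e))"
    unfolding w_def sum_eval eval2_mult eval2_power by (simp add: eval2_inf_unit eval2_const)
  also have "\<dots> = (\<Sum>e\<in>supp2 ?h. if e = multideg ?h then coeff2 ?h e else 0)"
  proof (rule sum.cong[OF refl])
    fix e assume "e \<in> supp2 ?h"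
    from lead[OF this]
    show "coeff2 ?h e * 0 ^ (W - wdeg e) = (if e = multideg ?h then coeff2 ?h e else 0)"
      by (cases "e = multideg ?h") (simp_all add: W_def power_0_left)
  qed
  also have "\<dots> = coeff2 ?h (multideg ?h)"
    using multideg_mem_supp2[OF nz] by (simp add: finite_supp2)
  finally have "eval2 w 0 0 \<noteq> 0" using multideg_mem_supp2[OF nz] by (simp add: supp2_def)
  from ord_at_inf_eqI[OF dvd this]
  show "ord_at ?F 0 0 (local_eq (homogenize ?h) Inf) = 3 * D - W" .
qed

lemma projective_plane_curve_homogenize:
  assumes "h \<noteq> 0" "total_degree2 h \<ge> 1"
  shows "projective_plane_curve (homogenize h)"
  unfolding projective_plane_curve_def
proof (intro conjI exI allI impI)
  show "homogenize h \<noteq> 0" using poly_homogenize_1[of h] assms(1) by auto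
  fix i j k assume nz: "coeff (coeff (coeff (homogenize h) k) j) i \<noteq> 0"
  have "coeff (coeff (coeff (homogenize h) k) j) i = (\<Sum>e\<in>supp2 h.
      coeff (coeff (coeff (monom (term2 (coeff2 h e) e) (total_degree2 h - (fst e + snd e))) k) j) i)"
    by (simp add: homogenize_def coeff_sum)
  with nz obtain e where e: "e \<in> supp2 h"
    "coeff (coeff (coeff (monom (term2 (coeff2 h e) e) (total_degree2 h - (fst e + snd e))) k) j) i \<noteq> 0"
    using sum.neutral by (metis (no_types, lifting))
  then have "k = total_degree2 h - (fst e + snd e)" "j = fst e" "i = snd e"
    by (auto simp: term2_def split: if_splits)
  then show "i + j + k = total_degree2 h" using total_degree2_ge[OF e(1)] by simp
qed (rule assms(2))

section \<open>Divisors\<close>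

text \<open>The line at infinity is the inflectional tangent at O, by u z = x^3; in the affine chart
  its equation is the constant 1.\<close>

lemma cut_divisor_z:
  fixes a b c :: "'a::field"
  assumes f: "f = cubic a b c"
  shows "cut_divisor f (monom 1 1) = (\<lambda>P. 3 * point_div Inf P)"
proof
  fix P
  show "cut_divisor f (monom 1 1) P = 3 * point_div Inf P"
  proof (cases P)
    case Inf
    have "local_eq (monom 1 1) Inf = (y_minus 0 :: 'a poly poly)"
      by (intro poly_eqI) (simp add: coeff_map_poly y_minus_def monom_Suc monom_0 coeff_pCons one_pCons
          split: nat.split)
    moreover have "ord_at (inf_eq a b c) 0 0 (y_minus 0) = 3"
      by (rule ord_at_inf_eqI[where N = 1 and w = 1]) (simp_all add: inf_unit_mult)
    ultimately show ?thesis
      unfolding Inf cut_divisor_def f local_eq_curve_eq_Inf by (simp add: ec_points_def point_div_def del: local_eq.simps)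
  next
    case (Aff x y)
    have "ord_at (curve_eq f) x y (1 :: 'a poly poly) = 0" if "y\<^sup>2 = poly f x"
      using that by (intro ord_at_eq_0) (simp_all add: eval2_curve_eq)
    then show ?thesis unfolding Aff cut_divisor_def
      by (auto simp: poly_homogenize_1 poly_monom point_div_def ec_points_def)
  qed
qed

text \<open>The degree of this divisor is three times that of the curve, as in Bezout's theorem. The
  truncated difference is exact by \<open>ord_at_homogenize_Inf(1)\<close>.\<close>

lemma cut_divisor_homogenize:
  fixes a b c :: "'a::field"
  assumes f: "f = cubic a b c" and two: "(2::'a) \<noteq> 0" and on: "q\<^sup>2 = poly f p"
    and mem: "[:b0, b1:] \<in> points_ideal (curve_eq f) (replicate n (p, q))"
    and N: "curve_norm f b0 b1 = smult r ([:-p, 1:] ^ n)" "r \<noteq> 0"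
    and nz: "[:b0, b1:] \<noteq> 0" and W: "wdeg (multideg [:b0, b1:]) = n"
  shows "cut_divisor f (homogenize [:b0, b1:]) =
    (\<lambda>P. int n * point_div (Aff p q) P + int (3 * total_degree2 [:b0, b1:] - n) * point_div Inf P)"
proof
  fix P
  show "cut_divisor f (homogenize [:b0, b1:]) P =
    int n * point_div (Aff p q) P + int (3 * total_degree2 [:b0, b1:] - n) * point_div Inf P"
  proof (cases P)
    case Inf
    show ?thesis unfolding Inf cut_divisor_def f local_eq_curve_eq_Inf
      using ord_at_homogenize_Inf(2)[OF nz, of a b c] W
      by (simp add: ec_points_def point_div_def del: local_eq.simps)
  next
    case (Aff x y)
    show ?thesis
    proof (cases "y\<^sup>2 = poly f x")
      case False
      then have "Aff x y \<notin> ec_points f" "Aff x y \<noteq> Aff p q" using on by (auto simp: ec_points_def)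
      then show ?thesis unfolding Aff cut_divisor_def by (auto simp: point_div_def)
    next
      case True
      then have "ord_at (curve_eq f) x y [:b0, b1:] = (if (x, y) = (p, q) then n else 0)"
        using ord_at_norm_power[OF two on mem N] eval2_other_nonzero[OF two on mem N True]
          ord_at_eq_0[of "curve_eq f" x y "[:b0, b1:]"] by (auto simp: eval2_curve_eq)
      then show ?thesis using True unfolding Aff cut_divisor_def
        by (auto simp: poly_homogenize_1 point_div_def ec_points_def)
    qed
  qed
qed

lemma sum_mset_point_div: "(\<Sum>P\<in>#Ps. point_div P Q) = int (count Ps Q)"
  by (induction Ps) (auto simp: point_div_def)

text \<open>Away from O the coefficients of the divisor are n times the multiplicities in
  \<open>Ps\<close>, so cancelling n determines the multiset.\<close>

lemma affine_contact_points_iff: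
  assumes T: "T \<in> ec_points f" "T \<noteq> Inf" and n: "n > 0"
    and cut: "cut_divisor f D = (\<lambda>P. int n * point_div T P + int s * point_div Inf P)"
  shows "affine_contact_points f n D Ps \<longleftrightarrow> Ps = {#T#}"
proof
  assume "affine_contact_points f n D Ps"
  then obtain s' :: nat where sub: "set_mset Ps \<subseteq> ec_points f - {Inf}"
    and eq: "cut_divisor f D = (\<lambda>Q. int n * (\<Sum>P\<in>#Ps. point_div P Q) + int s' * point_div Inf Q)"
    unfolding affine_contact_points_def by blast
  show "Ps = {#T#}"
  proof (rule multiset_eqI)
    fix Q
    show "count Ps Q = count {#T#} Q"
    proof (cases "Q = Inf")
      case True
      then have "Q \<notin># Ps" using sub by blast
      then show ?thesis using True T(2) by (simp add: not_in_iff)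
    next
      case False
      then have "int n * point_div T Q = int n * int (count Ps Q)"
        using fun_cong[OF eq, of Q] unfolding cut sum_mset_point_div by (simp add: point_div_def)
      then show ?thesis using n by (auto simp: point_div_def split: if_splits)
    qed
  qed
next
  assume Ps: "Ps = {#T#}"
  have "cut_divisor f D = (\<lambda>Q. int n * (\<Sum>P\<in>#Ps. point_div P Q) + int s * point_div Inf Q)"
    unfolding cut Ps by simp
  then show "affine_contact_points f n D Ps"
    unfolding affine_contact_points_def using T Ps by auto
qed

section \<open>Field embeddings\<close>

lemma field_hom_simps:
  assumes "field_hom \<iota>"
  shows "\<iota> 1 = 1" "\<iota> 0 = 0" "\<iota> (x + y) = \<iota> x + \<iota> y" "\<iota> (x * y) = \<iota> x * \<iota> y" "\<iota> (- x) = - \<iota> x"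
    "\<iota> (x - y) = \<iota> x - \<iota> y" "\<iota> (x ^ k) = \<iota> x ^ k" "\<iota> x = 0 \<longleftrightarrow> x = 0" "\<iota> x = \<iota> y \<longleftrightarrow> x = y"
    "\<iota> (x / y) = \<iota> x / \<iota> y" "\<iota> 2 = 2" "\<iota> 3 = 3"
proof -
  have one: "\<iota> 1 = 1" and add: "\<And>x y. \<iota> (x + y) = \<iota> x + \<iota> y" and mult: "\<And>x y. \<iota> (x * y) = \<iota> x * \<iota> y"
    using assms by (auto simp: field_hom_def)
  have zero: "\<iota> 0 = 0" using add[of 0 0] by (metis add.right_neutral add_left_cancel)
  have minus: "\<iota> (- x) = - \<iota> x" for x using add[of x "- x"] zero by (simp add: eq_neg_iff_add_eq_0 add.commute)
  have diff: "\<iota> (x - y) = \<iota> x - \<iota> y" for x y using add[of x "- y"] minus by simp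
  have power: "\<iota> (x ^ k) = \<iota> x ^ k" for x k by (induction k) (simp_all add: one mult)
  have eq0: "\<iota> x = 0 \<longleftrightarrow> x = 0" for x
    using mult[of x "inverse x"] one zero by (cases "x = 0") auto
  have inj: "\<iota> x = \<iota> y \<longleftrightarrow> x = y" for x y using diff[of x y] eq0[of "x - y"] by simp
  have div: "\<iota> (x / y) = \<iota> x / \<iota> y" for x y
  proof (cases "y = 0")
    case False
    then show ?thesis using mult[of "x / y" y] eq0[of y] by (simp add: field_simps)
  qed (simp add: zero)
  have two: "\<iota> 2 = 2" using add[of 1 1] one by simp
  have three: "\<iota> 3 = 3" using add[of 2 1] one two by simp
  show "\<iota> 1 = 1" "\<iota> 0 = 0" "\<iota> (x + y) = \<iota> x + \<iota> y" "\<iota> (x * y) = \<iota> x * \<iota> y" "\<iota> (- x) = - \<iota> x"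
    "\<iota> (x - y) = \<iota> x - \<iota> y" "\<iota> (x ^ k) = \<iota> x ^ k" "\<iota> x = 0 \<longleftrightarrow> x = 0" "\<iota> x = \<iota> y \<longleftrightarrow> x = y"
    "\<iota> (x / y) = \<iota> x / \<iota> y" "\<iota> 2 = 2" "\<iota> 3 = 3"
    by (fact one zero add mult minus diff power eq0 inj div two three)+
qed

lemma map_ec_add:
  assumes "field_hom \<iota>"
  shows "map_ec_point \<iota> (ec_add a b P Q) = ec_add (\<iota> a) (\<iota> b) (map_ec_point \<iota> P) (map_ec_point \<iota> Q)"
proof (cases P; cases Q)
  fix x1 y1 x2 y2 assume PQ: "P = Aff x1 y1" "Q = Aff x2 y2"
  note hom = field_hom_simps[OF assms]
  have "\<iota> y1 = - \<iota> y2 \<longleftrightarrow> y1 = - y2" by (simp only: hom(5)[symmetric] hom(9))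
  then show ?thesis unfolding PQ by (simp add: Let_def hom)
qed simp_all

lemma map_ec_mult:
  assumes "field_hom \<iota>"
  shows "map_ec_point \<iota> (ec_mult a b m P) = ec_mult (\<iota> a) (\<iota> b) m (map_ec_point \<iota> P)"
  by (induction m) (simp_all add: ec_mult_Suc map_ec_add[OF assms], simp_all add: ec_mult_def)

text \<open>The order of T is given over K, whereas Miller's functions are built over the closure.
  Only \<open>Inf\<close> is mapped to \<open>Inf\<close>.\<close>

lemma ec_has_order_map:
  assumes "field_hom \<iota>"
  shows "ec_has_order (\<iota> a) (\<iota> b) (map_ec_point \<iota> P) n \<longleftrightarrow> ec_has_order a b P n"
proof -
  have "ec_mult (\<iota> a) (\<iota> b) m (map_ec_point \<iota> P) = Inf \<longleftrightarrow> ec_mult a b m P = Inf" for m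
    unfolding map_ec_mult[OF assms, symmetric] by (cases "ec_mult a b m P") simp_all
  then show ?thesis by (simp add: ec_has_order_def)
qed

lemma two_nonzero_of_char:
  assumes "CHAR('a::field) \<noteq> 2"
  shows "(2::'a) \<noteq> 0"
proof
  assume "(2::'a) = 0"
  then have "of_nat 2 = (0::'a)" by simp
  then have "CHAR('a) dvd 2" by (simp only: of_nat_eq_0_iff_char_dvd)
  then have "CHAR('a) = 1"
    using assms prime_nat_iff two_is_prime_nat by blast
  then have "of_nat 1 = (0::'a)" by (simp only: of_nat_eq_0_iff_char_dvd dvd_refl)
  then show False by simp
qed

text \<open>The condition K = C is rendered by a field isomorphism onto \<open>complex\<close>. That
  \<open>b\<^sub>n\<^sub>T\<close> does not vanish identically on E is recorded because the orders
  in \<open>div_fun\<close> have their meaning only then.\<close>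

theorem mainTheorem3:
  fixes \<iota> :: "'k::field \<Rightarrow> 'l::alg_closed_field"
    and a b c x\<^sub>T y\<^sub>T :: 'k
    and n :: nat
    and f :: "'l poly"
    and T :: "'l ec_point"
    and J G :: "'l poly poly set"
    and b\<^sub>n\<^sub>T :: "'l poly poly"
  assumes char: "CHAR('k) \<noteq> 2"
    and closure: "algebraic_closure_emb \<iota>"
    and f_def: "f = cubic (\<iota> a) (\<iota> b) (\<iota> c)"
    and no_multiple_roots: "rsquarefree f"
    and T_on_E: "Aff x\<^sub>T y\<^sub>T \<in> ec_points (cubic a b c)"
    and T_def: "T = Aff (\<iota> x\<^sub>T) (\<iota> y\<^sub>T)"
    and n_ge_2: "n \<ge> 2"
    and order_T: "ec_has_order a b (Aff x\<^sub>T y\<^sub>T) n"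
    and J_def: "J = point_power_ideal (curve_eq f) (\<iota> x\<^sub>T) (\<iota> y\<^sub>T) n"
    and G_reduced: "reduced_groebner_basis J G"
    and b_mem: "b\<^sub>n\<^sub>T \<in> G - {curve_eq f}"
    and b_min: "\<forall>g \<in> G - {curve_eq f}. g \<noteq> b\<^sub>n\<^sub>T \<longrightarrow> multideg g >\<^sub>2 multideg b\<^sub>n\<^sub>T"
  shows "\<exists>b\<^sub>0 b\<^sub>1 :: 'l poly.
      b\<^sub>n\<^sub>T = [:b\<^sub>0, b\<^sub>1:] \<and>
      \<not> curve_eq f dvd b\<^sub>n\<^sub>T \<and>
      div_fun f b\<^sub>n\<^sub>T = (\<lambda>P. int n * point_div T P - int n * point_div Inf P) \<and>
      (\<exists>r::'k. r \<noteq> 0 \<and> b\<^sub>0 ^ 2 - b\<^sub>1 ^ 2 * f = smult (\<iota> r) ([:- \<iota> x\<^sub>T, 1:] ^ n)) \<and>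
      ((\<exists>\<phi> :: 'k \<Rightarrow> complex. field_hom \<phi> \<and> bij \<phi>) \<longrightarrow>
         weak_contact_curve f n (homogenize b\<^sub>n\<^sub>T) \<and>
         (\<forall>Ps. affine_contact_points f n (homogenize b\<^sub>n\<^sub>T) Ps \<longleftrightarrow> Ps = {#T#}))"
proof -
  let ?F = "curve_eq f" and ?p = "\<iota> x\<^sub>T" and ?q = "\<iota> y\<^sub>T"
  have hom: "field_hom \<iota>" using closure by (simp add: algebraic_closure_emb_def)
  note hom_simps = field_hom_simps[OF hom]
  have two: "(2::'l) \<noteq> 0"
    using two_nonzero_of_char[OF char] hom_simps(8)[of 2] hom_simps(11) by simp
  have "y\<^sub>T ^ 2 = poly (cubic a b c) x\<^sub>T" using T_on_E by (auto simp: ec_points_def)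
  then have on: "?q\<^sup>2 = poly f ?p"
    unfolding hom_simps(7)[symmetric] by (simp add: f_def cubic_def hom_simps)
  have ord: "ec_has_order (\<iota> a) (\<iota> b) (Aff ?p ?q) n"
    using order_T ec_has_order_map[OF hom, of a b "Aff x\<^sub>T y\<^sub>T" n] by simp
  have J: "J = points_ideal ?F (replicate n (?p, ?q))"
    unfolding J_def by (rule point_power_ideal_eq_points_ideal)
  have f: "degree f = 3" "lead_coeff f = 1" by (simp_all add: f_def cubic_def numeral_3_eq_3)
  obtain \<beta>0 \<beta>1 where \<beta>: "[:\<beta>0, \<beta>1:] \<in> J" "curve_norm f \<beta>0 \<beta>1 \<noteq> 0" "degree (curve_norm f \<beta>0 \<beta>1) = n"
    using exists_torsion_function[OF f_def no_multiple_roots two on n_ge_2 ord] unfolding J by blast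
  have \<beta>_nz: "[:\<beta>0, \<beta>1:] \<noteq> 0" using \<beta>(2) by (auto simp: curve_norm_def)
  have FJ: "?F \<in> J" unfolding J by (rule points_ideal_dvd) simp
  have diff: "g - h \<in> J" if "g \<in> J" "h \<in> J" for g h
    using that unfolding J by (rule points_ideal_diff)
  note minimal = minimal_element_reduced_groebner_basis[OF _ FJ diff G_reduced b_mem b_min \<beta>(1) \<beta>_nz,
      of "\<iota> a" "\<iota> b" "\<iota> c"]
  obtain b0 b1 where b: "b\<^sub>n\<^sub>T = [:b0, b1:]" using minimal(1) f_def by blast
  have bJ: "[:b0, b1:] \<in> points_ideal ?F (replicate n (?p, ?q))"
    using G_reduced b_mem b J by (auto simp: reduced_groebner_basis_def groebner_basis_def)
  have monic: "lead_coeff2 [:b0, b1:] = 1"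
    using G_reduced b_mem b by (auto simp: reduced_groebner_basis_def)
  then have nz: "[:b0, b1:] \<noteq> 0" by (auto simp: lead_coeff2_def coeff2_def)
  note N = curve_norm_degree[OF f nz]
  have "wdeg (multideg [:\<beta>0, \<beta>1:]) = n" using curve_norm_degree(2)[OF f \<beta>_nz] \<beta>(3) by simp
  with minimal(2) f_def b have le: "wdeg (multideg [:b0, b1:]) \<le> n" by simp
  obtain k where k: "curve_norm f b0 b1 = [:- ?p, 1:] ^ n * k"
    using curve_norm_dvd[OF on bJ] by (rule dvdE)
  with N(1) have "k \<noteq> 0" by auto
  with k have "degree (curve_norm f b0 b1) = n + degree k"
    by (simp add: degree_mult_eq degree_linear_power)
  \<comment> \<open>The norm has degree at most n and equals (x - x_T)^n times a nonzero k, so k is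
    constant and the weight is exactly n.\<close>
  with le N(2) have "degree k = 0" and W: "wdeg (multideg [:b0, b1:]) = n" by simp_all
  then obtain r' where "k = [:r':]" by (auto elim: degree_eq_zeroE)
  with k have N': "curve_norm f b0 b1 = smult r' ([:- ?p, 1:] ^ n)" by simp
  then have "lead_coeff (curve_norm f b0 b1) = r'" by (simp add: lead_coeff_power)
  \<comment> \<open>The remaining factor is monic, so r' is the leading coefficient of the norm.
    Both possible signs come from K, which yields \<open>r\<close>.\<close>
  with N(3) monic have "r' = 1 \<or> r' = - 1" by auto
  then have "\<exists>r. r \<noteq> 0 \<and> r' = \<iota> r"
  proof
    assume "r' = - 1"
    then show ?thesis by (intro exI[of _ "- 1"]) (simp add: hom_simps)
  qed (auto intro!: exI[of _ 1] simp: hom_simps)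
  then obtain r where r: "r \<noteq> 0" "r' = \<iota> r" by blast
  have r'_nz: "r' \<noteq> 0" using r hom_simps(8) by simp
  note D_ge = ord_at_homogenize_Inf(1)[OF nz, unfolded W]
  note cut = cut_divisor_homogenize[OF f_def two on bJ N' r'_nz nz W]
  have T: "T \<in> ec_points f" "T \<noteq> Inf" using on by (auto simp: T_def ec_points_def)
  have n: "n > 0" using n_ge_2 by simp
  have ndvd: "\<not> ?F dvd [:b0, b1:]" unfolding curve_eq_dvd_linear_iff using nz by simp
  \<comment> \<open>At O, with D the total degree, the coefficient is (3 D - n) - 3 D = - n;
    \<open>D_ge\<close> ensures that the inner difference is not truncated.\<close>
  have "div_fun f [:b0, b1:] = (\<lambda>P. int n * point_div T P - int n * point_div Inf P)"
    unfolding div_fun_def cut cut_divisor_z[OF f_def] T_def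
    using D_ge by (auto simp: of_nat_diff algebra_simps)
  moreover have contact: "affine_contact_points f n (homogenize [:b0, b1:]) Ps \<longleftrightarrow> Ps = {#T#}" for Ps
    by (rule affine_contact_points_iff[OF T n cut[folded T_def]])
  moreover have "weak_contact_curve f n (homogenize [:b0, b1:])"
    unfolding weak_contact_curve_def
  proof (intro conjI)
    show "projective_plane_curve (homogenize [:b0, b1:])"
      \<comment> \<open>The total degree D is positive because 0 < n \<le> 3 D.\<close>
      using nz D_ge n by (intro projective_plane_curve_homogenize) auto
    show "\<not> homogenize ?F dvd homogenize [:b0, b1:]"
    proof
      assume "homogenize ?F dvd homogenize [:b0, b1:]"
      then obtain g where "homogenize [:b0, b1:] = homogenize ?F * g" by (rule dvdE)
      then have "poly (homogenize [:b0, b1:]) 1 = poly (homogenize ?F * g) 1" by simp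
      then have "[:b0, b1:] = ?F * poly g 1" by (simp only: poly_mult poly_homogenize_1)
      then have "?F dvd [:b0, b1:]" by (rule dvdI)
      with ndvd show False by contradiction
    qed
    show "\<exists>Ps. affine_contact_points f n (homogenize [:b0, b1:]) Ps" using contact by blast
  qed
  moreover have "b0 ^ 2 - b1 ^ 2 * f = smult (\<iota> r) ([:- ?p, 1:] ^ n)"
    using N' unfolding curve_norm_def r(2) .
  ultimately show ?thesis using b ndvd r(1) by blast
qed

end
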